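(* Let $S$ be any left cancellative semigroup. There is a surjective $*$-homomorphism $\eta:C^*(S)\to C^*_0(I_l(S))$ such that $\eta(v_s)=\lambda_s$ for each $s\in S$ (where $\lambda_s$ also denotes its canonical image in $C^*_0(I_l(S))$). If $S$ satisfies Clifford's condition, then $\eta$ is an isomorphism.
   Context: A semigroup means a set with associative product and identity element $1$. $S$ is left cancellative if $sr=st$ implies $r=t$. $S$ satisfies Clifford's condition if for all $s,t\in S$, either $sS\cap tS=\varnothing$ or $sS\cap tS=rS$ for some $r\in S$. For $X\subset S$, $sX=\{sx:x\in X\}$ and $t^{-1}X=\{r\in S:tr\in X\}$. $J(S)$ is the set of all finite intersections of subsets of $S$ of the form $t_1^{-1}s_1\cdots t_n^{-1}s_nS$ ($n\ge1$, $s_i,t_i\in S$). $C^*(S)$ (Li) is the universal $C^*$-algebra generated by isometries $\{v_s:s\in S\}$ and projections $\{e_X:X\in J(S)\cup\{\varnothing\}\}$ such that for all $s,t\in S$ and $X,Y\in J(S)\cup\{\varnothing\}$: $v_{st}=v_sv_t$, $v_se_Xv_s^*=e_{sX}$, $e_S=1$, $e_\varnothing=0$, $e_{X\cap Y}=e_Xe_Y$. For $s\in S$ let $\lambda_s:S\to sS$, $\lambda_s(t)=st$. $I(S)$ is the inverse semigroup of all partially defined bijections of $S$ (product $fg$ is composition on $g^{-1}(\mathrm{dom} f)$; $f^*$ is the inverse map; the empty map is the zero $0$). $I_l(S)$ is the inverse subsemigroup of $I(S)$ generated by $\{\lambda_s\}_{s\in S}$. For an inverse semigroup $P$, $C^*(P)$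 is the full $C^*$-algebra of $P$: the enveloping $C^*$-algebra of the convolution algebra $\ell^1(P)$, universal for representations of $P$ by partial isometries (homomorphisms $P\to A$, $A$ a $C^*$-algebra, onto a multiplicative semigroup of partial isometries); $P$ is identified with its image in $C^*(P)$. For $P=I_l(S)$, $C^*_0(P)=C^*(P)/\mathbb{C}0$ if the empty map $0$ lies in $P$, and $C^*_0(P)=C^*(P)$ otherwise. *)

theory Defs
  imports Complex_Main "HOL-Algebra.QuotRing" "HOL-Algebra.Module"
begin

section \<open>C*-algebras on carrier sets\<close>

definition complex_ring :: "complex ring" where
  "complex_ring = \<lparr>carrier = UNIV, mult = (*), one = 1, zero = 0, add = (+)\<rparr>"

record 'a cstar = "(complex, 'a) module" +
  adj :: "'a \<Rightarrow> 'a"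
  cnorm :: "'a \<Rightarrow> real"

text \<open>
  C*-algebras need not be unital: the record field \<open>one\<close> is left unconstrained here and
  only becomes meaningful in the locale \<open>unital_cstar_algebra\<close> below.
\<close>

locale cstar_algebra = module complex_ring A for A :: "'a cstar" (structure) +
  assumes mult_closed: "\<lbrakk>x \<in> carrier A; y \<in> carrier A\<rbrakk> \<Longrightarrow> x \<otimes> y \<in> carrier A"
    and mult_assoc: "\<lbrakk>x \<in> carrier A; y \<in> carrier A; z \<in> carrier A\<rbrakk>
      \<Longrightarrow> (x \<otimes> y) \<otimes> z = x \<otimes> (y \<otimes> z)"
    and mult_l_distr: "\<lbrakk>x \<in> carrier A; y \<in> carrier A; z \<in> carrier A\<rbrakk>
      \<Longrightarrow> (x \<oplus> y) \<otimes> z = x \<otimes> z \<oplus> y \<otimes> z"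
    and mult_r_distr: "\<lbrakk>x \<in> carrier A; y \<in> carrier A; z \<in> carrier A\<rbrakk>
      \<Longrightarrow> z \<otimes> (x \<oplus> y) = z \<otimes> x \<oplus> z \<otimes> y"
    and smult_mult_l: "\<lbrakk>x \<in> carrier A; y \<in> carrier A\<rbrakk>
      \<Longrightarrow> (c \<odot>\<^bsub>A\<^esub> x) \<otimes> y = c \<odot>\<^bsub>A\<^esub> (x \<otimes> y)"
    and smult_mult_r: "\<lbrakk>x \<in> carrier A; y \<in> carrier A\<rbrakk>
      \<Longrightarrow> x \<otimes> (c \<odot>\<^bsub>A\<^esub> y) = c \<odot>\<^bsub>A\<^esub> (x \<otimes> y)"
    and adj_closed: "x \<in> carrier A \<Longrightarrow> adj A x \<in> carrier A"
    and adj_adj: "x \<in> carrier A \<Longrightarrow> adj A (adj A x) = x"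
    and adj_add: "\<lbrakk>x \<in> carrier A; y \<in> carrier A\<rbrakk> \<Longrightarrow> adj A (x \<oplus> y) = adj A x \<oplus> adj A y"
    and adj_smult: "x \<in> carrier A \<Longrightarrow> adj A (c \<odot>\<^bsub>A\<^esub> x) = cnj c \<odot>\<^bsub>A\<^esub> adj A x"
    and adj_mult: "\<lbrakk>x \<in> carrier A; y \<in> carrier A\<rbrakk> \<Longrightarrow> adj A (x \<otimes> y) = adj A y \<otimes> adj A x"
    and cnorm_nonneg: "x \<in> carrier A \<Longrightarrow> 0 \<le> cnorm A x"
    and cnorm_eq_zero: "x \<in> carrier A \<Longrightarrow> cnorm A x = 0 \<longleftrightarrow> x = \<zero>"
    and cnorm_triangle: "\<lbrakk>x \<in> carrier A; y \<in> carrier A\<rbrakk>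
      \<Longrightarrow> cnorm A (x \<oplus> y) \<le> cnorm A x + cnorm A y"
    and cnorm_smult: "x \<in> carrier A \<Longrightarrow> cnorm A (c \<odot>\<^bsub>A\<^esub> x) = cmod c * cnorm A x"
    and cnorm_mult: "\<lbrakk>x \<in> carrier A; y \<in> carrier A\<rbrakk>
      \<Longrightarrow> cnorm A (x \<otimes> y) \<le> cnorm A x * cnorm A y"
    and cstar_identity: "x \<in> carrier A \<Longrightarrow> cnorm A (adj A x \<otimes> x) = (cnorm A x)\<^sup>2"
    and complete: "\<lbrakk>range f \<subseteq> carrier A;
        \<And>\<epsilon>. \<epsilon> > 0 \<Longrightarrow> \<exists>N. \<forall>m\<ge>N. \<forall>n\<ge>N. cnorm A (f m \<ominus> f n) < \<epsilon>\<rbrakk>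
      \<Longrightarrow> \<exists>l\<in>carrier A. (\<lambda>n::nat. cnorm A (f n \<ominus> l)) \<longlonglongrightarrow> 0"

locale unital_cstar_algebra = cstar_algebra +
  assumes unit_closed: "\<one> \<in> carrier A"
    and unit_l: "x \<in> carrier A \<Longrightarrow> \<one> \<otimes> x = x"
    and unit_r: "x \<in> carrier A \<Longrightarrow> x \<otimes> \<one> = x"

definition star_hom :: "'a cstar \<Rightarrow> 'b cstar \<Rightarrow> ('a \<Rightarrow> 'b) \<Rightarrow> bool" where
  "star_hom A B \<phi> \<longleftrightarrow>
     \<phi> \<in> carrier A \<rightarrow> carrier B \<and>
     (\<forall>x\<in>carrier A. \<forall>y\<in>carrier A. \<phi> (x \<oplus>\<^bsub>A\<^esub> y) = \<phi> x \<oplus>\<^bsub>B\<^esub> \<phi> y) \<and>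
     (\<forall>c. \<forall>x\<in>carrier A. \<phi> (c \<odot>\<^bsub>A\<^esub> x) = c \<odot>\<^bsub>B\<^esub> \<phi> x) \<and>
     (\<forall>x\<in>carrier A. \<forall>y\<in>carrier A. \<phi> (x \<otimes>\<^bsub>A\<^esub> y) = \<phi> x \<otimes>\<^bsub>B\<^esub> \<phi> y) \<and>
     (\<forall>x\<in>carrier A. \<phi> (adj A x) = adj B (\<phi> x))"

definition cstar_subalgebra :: "'a cstar \<Rightarrow> 'a set \<Rightarrow> bool" where
  "cstar_subalgebra A B \<longleftrightarrow>
     B \<subseteq> carrier A \<and> \<zero>\<^bsub>A\<^esub> \<in> B \<and>
     (\<forall>x\<in>B. \<forall>y\<in>B. x \<oplus>\<^bsub>A\<^esub> y \<in> B) \<and>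
     (\<forall>c. \<forall>x\<in>B. c \<odot>\<^bsub>A\<^esub> x \<in> B) \<and>
     (\<forall>x\<in>B. \<forall>y\<in>B. x \<otimes>\<^bsub>A\<^esub> y \<in> B) \<and>
     (\<forall>x\<in>B. adj A x \<in> B) \<and>
     (\<forall>f. \<forall>l\<in>carrier A. range f \<subseteq> B \<and> (\<lambda>n::nat. cnorm A (f n \<ominus>\<^bsub>A\<^esub> l)) \<longlonglongrightarrow> 0 \<longrightarrow> l \<in> B)"

definition cstar_generated_by :: "'a cstar \<Rightarrow> 'a set \<Rightarrow> bool" where
  "cstar_generated_by A X \<longleftrightarrow>
     X \<subseteq> carrier A \<and> (\<forall>B. cstar_subalgebra A B \<and> X \<subseteq> B \<longrightarrow> B = carrier A)"

text \<open>
  The quotient of a C*-algebra by a closed two-sided ideal, with the quotient norm. The scalar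
  multiple of a coset is written as a union of cosets so that it is again a coset for scalar 0.
\<close>

definition cstar_quot :: "'a cstar \<Rightarrow> 'a set \<Rightarrow> 'a set cstar" where
  "cstar_quot A N =
     \<lparr>carrier = carrier (A Quot N), mult = mult (A Quot N), one = one (A Quot N),
      zero = zero (A Quot N), add = add (A Quot N),
      smult = (\<lambda>c K. \<Union>x\<in>K. N +>\<^bsub>A\<^esub> (c \<odot>\<^bsub>A\<^esub> x)),
      adj = (\<lambda>K. adj A ` K),
      cnorm = (\<lambda>K. INF x\<in>K. cnorm A x)\<rparr>"

section \<open>Left cancellative semigroups with identity\<close>

definition left_cancellative :: "('s, 'm) monoid_scheme \<Rightarrow> bool" where
  "left_cancellative S \<longleftrightarrow>
     (\<forall>s\<in>carrier S. \<forall>r\<in>carrier S. \<forall>t\<in>carrier S. s \<otimes>\<^bsub>S\<^esub> r = s \<otimes>\<^bsub>S\<^esub> t \<longrightarrow> r = t)"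

definition clifford :: "('s, 'm) monoid_scheme \<Rightarrow> bool" where
  "clifford S \<longleftrightarrow>
     (\<forall>s\<in>carrier S. \<forall>t\<in>carrier S.
        (s <#\<^bsub>S\<^esub> carrier S) \<inter> (t <#\<^bsub>S\<^esub> carrier S) = {} \<or>
        (\<exists>r\<in>carrier S. (s <#\<^bsub>S\<^esub> carrier S) \<inter> (t <#\<^bsub>S\<^esub> carrier S) = r <#\<^bsub>S\<^esub> carrier S))"

definition lpre :: "('s, 'm) monoid_scheme \<Rightarrow> 's \<Rightarrow> 's set \<Rightarrow> 's set" where
  "lpre S t X = {r \<in> carrier S. t \<otimes>\<^bsub>S\<^esub> r \<in> X}"

inductive_set basic_ideals :: "('s, 'm) monoid_scheme \<Rightarrow> 's set set"
  for S :: "('s, 'm) monoid_scheme" where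
  base: "\<lbrakk>s \<in> carrier S; t \<in> carrier S\<rbrakk> \<Longrightarrow> lpre S t (s <#\<^bsub>S\<^esub> carrier S) \<in> basic_ideals S"
| step: "\<lbrakk>s \<in> carrier S; t \<in> carrier S; X \<in> basic_ideals S\<rbrakk>
    \<Longrightarrow> lpre S t (s <#\<^bsub>S\<^esub> X) \<in> basic_ideals S"

definition constructible_ideals :: "('s, 'm) monoid_scheme \<Rightarrow> 's set set" where
  "constructible_ideals S = {\<Inter>F | F. finite F \<and> F \<noteq> {} \<and> F \<subseteq> basic_ideals S}"

section \<open>Li's algebra of a left cancellative semigroup\<close>

definition li_family ::
    "('s, 'm) monoid_scheme \<Rightarrow> 'a cstar \<Rightarrow> ('s \<Rightarrow> 'a) \<Rightarrow> ('s set \<Rightarrow> 'a) \<Rightarrow> bool" where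
  "li_family S A v e \<longleftrightarrow>
     (\<forall>s\<in>carrier S. v s \<in> carrier A \<and> adj A (v s) \<otimes>\<^bsub>A\<^esub> v s = \<one>\<^bsub>A\<^esub>) \<and>
     (\<forall>X\<in>constructible_ideals S \<union> {{}}.
        e X \<in> carrier A \<and> adj A (e X) = e X \<and> e X \<otimes>\<^bsub>A\<^esub> e X = e X) \<and>
     (\<forall>s\<in>carrier S. \<forall>t\<in>carrier S. v (s \<otimes>\<^bsub>S\<^esub> t) = v s \<otimes>\<^bsub>A\<^esub> v t) \<and>
     (\<forall>s\<in>carrier S. \<forall>X\<in>constructible_ideals S \<union> {{}}.
        v s \<otimes>\<^bsub>A\<^esub> e X \<otimes>\<^bsub>A\<^esub> adj A (v s) = e (s <#\<^bsub>S\<^esub> X)) \<and>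
     e (carrier S) = \<one>\<^bsub>A\<^esub> \<and>
     e {} = \<zero>\<^bsub>A\<^esub> \<and>
     (\<forall>X\<in>constructible_ideals S \<union> {{}}. \<forall>Y\<in>constructible_ideals S \<union> {{}}.
        e (X \<inter> Y) = e X \<otimes>\<^bsub>A\<^esub> e Y)"

text \<open>
  Universal C*-algebras are characterised by their universal property. A HOL formula cannot
  quantify over types, so the property is relative to all C*-algebras whose carrier is a set of
  elements of a type \<open>'b\<close>, which is given as an extra argument. The absolute universal
  property is the conjunction of all instances of \<open>'b\<close>, so assuming a single instance is a
  weaker hypothesis. Uniqueness of the induced homomorphism follows from generation.
\<close>

definition li_cstar_algebra ::
    "'b itself \<Rightarrow> ('s, 'm) monoid_scheme \<Rightarrow> 'a cstar \<Rightarrow> ('s \<Rightarrow> 'a) \<Rightarrow> ('s set \<Rightarrow> 'a) \<Rightarrow> bool"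
  where
  "li_cstar_algebra T S A v e \<longleftrightarrow>
     unital_cstar_algebra A \<and> li_family S A v e \<and>
     cstar_generated_by A (v ` carrier S \<union> e ` (constructible_ideals S \<union> {{}})) \<and>
     (\<forall>(B :: 'b cstar) w f. unital_cstar_algebra B \<and> li_family S B w f \<longrightarrow>
        (\<exists>\<phi>. star_hom A B \<phi> \<and> (\<forall>s\<in>carrier S. \<phi> (v s) = w s) \<and>
             (\<forall>X\<in>constructible_ideals S \<union> {{}}. \<phi> (e X) = f X)))"

section \<open>The inverse semigroup generated by the left translations\<close>

definition pinverse :: "('s \<rightharpoonup> 's) \<Rightarrow> ('s \<rightharpoonup> 's)" where
  "pinverse f = (\<lambda>y. if y \<in> ran f then Some (THE x. f x = Some y) else None)"

definition ltrans :: "('s, 'm) monoid_scheme \<Rightarrow> 's \<Rightarrow> ('s \<rightharpoonup> 's)" where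
  "ltrans S s = (\<lambda>t. if t \<in> carrier S then Some (s \<otimes>\<^bsub>S\<^esub> t) else None)"

text \<open>
  For left cancellative \<open>S\<close> the maps below are partial bijections of \<open>carrier S\<close>, and
  \<open>f \<circ>\<^sub>m g\<close> has domain \<open>{x \<in> dom g. the (g x) \<in> dom f}\<close>.
\<close>

inductive_set left_hull_carrier :: "('s, 'm) monoid_scheme \<Rightarrow> ('s \<rightharpoonup> 's) set"
  for S :: "('s, 'm) monoid_scheme" where
  gen: "s \<in> carrier S \<Longrightarrow> ltrans S s \<in> left_hull_carrier S"
| comp: "\<lbrakk>f \<in> left_hull_carrier S; g \<in> left_hull_carrier S\<rbrakk>
    \<Longrightarrow> f \<circ>\<^sub>m g \<in> left_hull_carrier S"
| inverse: "f \<in> left_hull_carrier S \<Longrightarrow> pinverse f \<in> left_hull_carrier S"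

definition left_hull :: "('s, 'm) monoid_scheme \<Rightarrow> ('s \<rightharpoonup> 's) monoid" where
  "left_hull S = \<lparr>carrier = left_hull_carrier S, mult = (\<circ>\<^sub>m), one = ltrans S \<one>\<^bsub>S\<^esub>\<rparr>"

section \<open>C*-algebras of inverse semigroups\<close>

definition pi_representation :: "('p, 'm) monoid_scheme \<Rightarrow> 'a cstar \<Rightarrow> ('p \<Rightarrow> 'a) \<Rightarrow> bool" where
  "pi_representation P A \<pi> \<longleftrightarrow>
     \<pi> \<in> hom P A \<and> (\<forall>p\<in>carrier P. \<pi> p \<otimes>\<^bsub>A\<^esub> adj A (\<pi> p) \<otimes>\<^bsub>A\<^esub> \<pi> p = \<pi> p)"

text \<open>
  The enveloping C*-algebra of \<open>l\<^sup>1(P)\<close>, given by its universal property: it is generated by, and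
  universal for, representations of \<open>P\<close> by partial isometries; \<open>\<iota> p\<close> is the image of the point
  mass at \<open>p\<close>. For an inverse semigroup \<open>P\<close> a multiplicative map into partial isometries
  automatically preserves adjoints.
\<close>

definition full_cstar_algebra ::
    "'b itself \<Rightarrow> ('p, 'm) monoid_scheme \<Rightarrow> 'c cstar \<Rightarrow> ('p \<Rightarrow> 'c) \<Rightarrow> bool" where
  "full_cstar_algebra T P C \<iota> \<longleftrightarrow>
     cstar_algebra C \<and> pi_representation P C \<iota> \<and> cstar_generated_by C (\<iota> ` carrier P) \<and>
     (\<forall>(B :: 'b cstar) \<pi>. cstar_algebra B \<and> pi_representation P B \<pi> \<longrightarrow>
        (\<exists>\<phi>. star_hom C B \<phi> \<and> (\<forall>p\<in>carrier P. \<phi> (\<iota> p) = \<pi> p)))"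

text \<open>
  \<open>zero_part S C \<iota>\<close> is the ideal spanned by the image of the empty map, if the empty map belongs
  to the inverse semigroup. Otherwise it is the zero ideal, and the quotient by it is the
  canonical copy of \<open>C\<close> whose elements are the singletons.
\<close>

definition zero_part :: "('s, 'm) monoid_scheme \<Rightarrow> 'c cstar \<Rightarrow> (('s \<rightharpoonup> 's) \<Rightarrow> 'c) \<Rightarrow> 'c set" where
  "zero_part S C \<iota> =
     (if Map.empty \<in> carrier (left_hull S) then {c \<odot>\<^bsub>C\<^esub> \<iota> Map.empty | c. True} else {\<zero>\<^bsub>C\<^esub>})"

definition reduced_by_zero ::
    "('s, 'm) monoid_scheme \<Rightarrow> 'c cstar \<Rightarrow> (('s \<rightharpoonup> 's) \<Rightarrow> 'c) \<Rightarrow> 'c set cstar" where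
  "reduced_by_zero S C \<iota> = cstar_quot C (zero_part S C \<iota>)"

definition reduced_image ::
    "('s, 'm) monoid_scheme \<Rightarrow> 'c cstar \<Rightarrow> (('s \<rightharpoonup> 's) \<Rightarrow> 'c) \<Rightarrow> ('s \<rightharpoonup> 's) \<Rightarrow> 'c set" where
  "reduced_image S C \<iota> p = zero_part S C \<iota> +>\<^bsub>C\<^esub> \<iota> p"

end

theory Submission
  imports Defs
begin

text \<open>
  The universal property of Li's algebra applied to the classes of \<open>\<lambda>\<^sub>s\<close> and of the identity
  maps on constructible ideals yields \<open>\<eta>\<close>. Its range contains the generators, so surjectivity
  amounts to the range of a unital *-homomorphism being closed. This is obtained without spectral
  theory from the fact that a self-adjoint element of norm below \<open>2\<close> is the sum of a unitary and
  its adjoint: it gives contractivity of *-homomorphisms, and it bounds the Chebyshev polynomial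
  \<open>c\<^sup>3 - 3 c\<close>, which serves to lift elements of the range with control of the norm.

  Under Clifford's condition every nonzero element of the left inverse hull has the form
  \<open>\<lambda>\<^sub>s \<lambda>\<^sub>t\<^sup>-\<^sup>1\<close>, and \<open>\<lambda>\<^sub>s \<lambda>\<^sub>t\<^sup>-\<^sup>1 \<mapsto> v\<^sub>s v\<^sub>t\<^sup>*\<close>, \<open>0 \<mapsto> 0\<close> is a representation by partial
  isometries. The homomorphism it induces on the quotient is a left inverse of \<open>\<eta>\<close>.
\<close>

section \<open>Elementary theory of C*-algebras\<close>

text \<open>The usual route to a closed range divides by the kernel and uses that injective
  homomorphisms are isometric. Here the argument is that of the open mapping theorem: an element of
  the closure is lifted by successive corrections, and all that has to be supplied is a lift with
  norm at most a fixed multiple of the norm of its target. If c = u + u* with u unitary, then c^3 -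
  3c = u^3 + u*^3, the identity behind 2 cos 3x, so the norm stays at most 2. Rescaled to have
  linear term h, this polynomial shrinks a large lift while hardly moving a small image.

  The ideal of the empty map also has a special shape: since 0 absorbs all maps, its image is a
  central projection z, and the quotient is a copy of the complementary corner, with the quotient
  norm attained. Taking z = 0 covers the case in which the empty map is absent.

  The pair (s,t) is determined by its fraction only up to a common right factor x with xS = S. For
  such x the isometry v_x is unitary, because the projection of xS is 1; hence the assignment on
  fractions is well defined.\<close>

lemma complex_ring_simps [simp]:
  "carrier complex_ring = UNIV" "mult complex_ring = (*)" "one complex_ring = 1"
  "zero complex_ring = 0" "add complex_ring = (+)"
  by (simp_all add: complex_ring_def)

lemma complex_ring_cring: "cring complex_ring"
proof (rule cringI)
  show "abelian_group complex_ring"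
  proof (rule abelian_groupI)
    fix x :: complex
    show "\<exists>y\<in>carrier complex_ring. y \<oplus>\<^bsub>complex_ring\<^esub> x = \<zero>\<^bsub>complex_ring\<^esub>"
      by (rule bexI[of _ "- x"]) simp_all
  qed (simp_all add: algebra_simps)
  show "comm_monoid complex_ring"
    by (rule comm_monoidI) (simp_all add: algebra_simps)
qed (simp_all add: algebra_simps)

section \<open>Arithmetic in C*-algebras that may lack a unit\<close>

context cstar_algebra
begin

lemma smult_mem [simp]: "x \<in> carrier A \<Longrightarrow> c \<odot>\<^bsub>A\<^esub> x \<in> carrier A"
  using smult_closed by simp

lemma smult_add_left: "x \<in> carrier A \<Longrightarrow> (a + b) \<odot>\<^bsub>A\<^esub> x = a \<odot>\<^bsub>A\<^esub> x \<oplus> b \<odot>\<^bsub>A\<^esub> x"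
  using smult_l_distr[of a b x] by simp

lemma smult_add_right:
  "\<lbrakk>x \<in> carrier A; y \<in> carrier A\<rbrakk> \<Longrightarrow> a \<odot>\<^bsub>A\<^esub> (x \<oplus> y) = a \<odot>\<^bsub>A\<^esub> x \<oplus> a \<odot>\<^bsub>A\<^esub> y"
  using smult_r_distr[of a x y] by simp

lemma smult_smult [simp]: "x \<in> carrier A \<Longrightarrow> a \<odot>\<^bsub>A\<^esub> (b \<odot>\<^bsub>A\<^esub> x) = (a * b) \<odot>\<^bsub>A\<^esub> x"
  using smult_assoc1[of a b x] by simp

lemma smult_1 [simp]: "x \<in> carrier A \<Longrightarrow> 1 \<odot>\<^bsub>A\<^esub> x = x"
  using smult_one[of x] by simp

lemmas [simp] = mult_closed adj_closed adj_adj cnorm_nonneg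

lemma smult_0 [simp]: "x \<in> carrier A \<Longrightarrow> 0 \<odot>\<^bsub>A\<^esub> x = \<zero>"
  using smult_l_null[of x] by simp

lemma smult_zero [simp]: "c \<odot>\<^bsub>A\<^esub> \<zero> = \<zero>"
  using smult_r_null[of c] by simp

lemma minus_smult: "x \<in> carrier A \<Longrightarrow> \<ominus> x = (- 1) \<odot>\<^bsub>A\<^esub> x"
proof -
  assume x: "x \<in> carrier A"
  have "(- 1) \<odot>\<^bsub>A\<^esub> x \<oplus> x = \<zero>"
    using smult_add_left[OF x, of "-1" 1] x by simp
  then show ?thesis using x by (simp add: minus_equality)
qed

lemma diff_smult: "\<lbrakk>x \<in> carrier A; y \<in> carrier A\<rbrakk> \<Longrightarrow> x \<ominus> y = x \<oplus> (- 1) \<odot>\<^bsub>A\<^esub> y"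
  by (simp add: minus_eq minus_smult)

lemma zero_mult [simp]: "x \<in> carrier A \<Longrightarrow> \<zero> \<otimes> x = \<zero>"
  using smult_mult_l[of \<zero> x 0] by simp

lemma mult_zero [simp]: "x \<in> carrier A \<Longrightarrow> x \<otimes> \<zero> = \<zero>"
  using smult_mult_r[of x \<zero> 0] by simp

lemma adj_zero [simp]: "adj A \<zero> = \<zero>"
  using adj_smult[of \<zero> 0] by simp

lemma diff_mult:
  "\<lbrakk>x \<in> carrier A; y \<in> carrier A; z \<in> carrier A\<rbrakk> \<Longrightarrow> (x \<ominus> y) \<otimes> z = x \<otimes> z \<ominus> y \<otimes> z"
  by (simp add: diff_smult mult_l_distr smult_mult_l)

lemma mult_diff:
  "\<lbrakk>x \<in> carrier A; y \<in> carrier A; z \<in> carrier A\<rbrakk> \<Longrightarrow> z \<otimes> (x \<ominus> y) = z \<otimes> x \<ominus> z \<otimes> y"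
  by (simp add: diff_smult mult_r_distr smult_mult_r)

lemma adj_diff:
  "\<lbrakk>x \<in> carrier A; y \<in> carrier A\<rbrakk> \<Longrightarrow> adj A (x \<ominus> y) = adj A x \<ominus> adj A y"
  by (simp add: diff_smult adj_add adj_smult)

lemma smult_diff:
  "\<lbrakk>x \<in> carrier A; y \<in> carrier A\<rbrakk> \<Longrightarrow> c \<odot>\<^bsub>A\<^esub> (x \<ominus> y) = c \<odot>\<^bsub>A\<^esub> x \<ominus> c \<odot>\<^bsub>A\<^esub> y"
  by (simp add: diff_smult smult_add_right)

lemma add_diff_add:
  "\<lbrakk>x \<in> carrier A; y \<in> carrier A; x' \<in> carrier A; y' \<in> carrier A\<rbrakk>
    \<Longrightarrow> (x \<oplus> y) \<ominus> (x' \<oplus> y') = (x \<ominus> x') \<oplus> (y \<ominus> y')"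
  by (simp add: diff_smult smult_add_right a_ac)

lemma diff_zero [simp]: "x \<in> carrier A \<Longrightarrow> x \<ominus> \<zero> = x"
  by (simp add: diff_smult)

lemma diff_self [simp]: "x \<in> carrier A \<Longrightarrow> x \<ominus> x = \<zero>"
  by (simp add: minus_eq r_neg)

lemma diff_eq_zero: "\<lbrakk>x \<in> carrier A; y \<in> carrier A\<rbrakk> \<Longrightarrow> x \<ominus> y = \<zero> \<longleftrightarrow> x = y"
  by (metis diff_self minus_closed minus_eq minus_equality minus_minus a_inv_closed)

lemma diff_add_cancel [simp]: "\<lbrakk>x \<in> carrier A; y \<in> carrier A\<rbrakk> \<Longrightarrow> (x \<ominus> y) \<oplus> y = x"
  by (simp add: minus_eq a_assoc l_neg)

lemma diff_add_diff:
  "\<lbrakk>x \<in> carrier A; y \<in> carrier A; z \<in> carrier A\<rbrakk> \<Longrightarrow> (x \<ominus> y) \<oplus> (y \<ominus> z) = x \<ominus> z"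
  by (simp add: a_assoc[symmetric] minus_eq[of _ z])

lemma diff_diff_diff:
  assumes "x \<in> carrier A" "y \<in> carrier A" "z \<in> carrier A"
  shows "(x \<ominus> z) \<ominus> (y \<ominus> z) = x \<ominus> y"
proof -
  have "\<ominus> (y \<ominus> z) = z \<ominus> y" using assms by (simp add: minus_eq minus_add a_comm)
  then show ?thesis using assms diff_add_diff[of x z y] minus_eq[of "x \<ominus> z" "y \<ominus> z"] by simp
qed

lemma cnorm_zero [simp]: "cnorm A \<zero> = 0"
  by (simp add: cnorm_eq_zero)

lemma cnorm_diff_comm: "\<lbrakk>x \<in> carrier A; y \<in> carrier A\<rbrakk> \<Longrightarrow> cnorm A (x \<ominus> y) = cnorm A (y \<ominus> x)"
  using cnorm_smult[of "y \<ominus> x" "-1"] by (simp add: diff_smult smult_add_right a_comm)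

lemma cnorm_diff_triangle:
  "\<lbrakk>x \<in> carrier A; y \<in> carrier A; z \<in> carrier A\<rbrakk>
    \<Longrightarrow> cnorm A (x \<ominus> z) \<le> cnorm A (x \<ominus> y) + cnorm A (y \<ominus> z)"
  using cnorm_triangle[of "x \<ominus> y" "y \<ominus> z"] by (simp add: diff_add_diff)

lemma cnorm_le_diff: "\<lbrakk>x \<in> carrier A; y \<in> carrier A\<rbrakk> \<Longrightarrow> cnorm A x \<le> cnorm A y + cnorm A (x \<ominus> y)"
  using cnorm_triangle[of "x \<ominus> y" y] by simp

lemma adj_mult_self_eq_zero: "x \<in> carrier A \<Longrightarrow> adj A x \<otimes> x = \<zero> \<Longrightarrow> x = \<zero>"
  using cstar_identity[of x] cnorm_eq_zero[of x] by simp

text \<open>The C*-identity bounds the square of the norm of y by the product of the norms of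
  \<open>adj A y\<close> and y. Division gives one inequality, and y may be replaced by its
  adjoint.\<close>

lemma cnorm_adj [simp]: assumes "x \<in> carrier A" shows "cnorm A (adj A x) = cnorm A x"
proof -
  have le: "cnorm A y \<le> cnorm A (adj A y)" if y: "y \<in> carrier A" for y
  proof (cases "cnorm A y = 0")
    case False
    then have "0 < cnorm A y" using y cnorm_nonneg[of y] by linarith
    moreover have "cnorm A y * cnorm A y \<le> cnorm A (adj A y) * cnorm A y"
      using cstar_identity[OF y] cnorm_mult[of "adj A y" y] y by (simp add: power2_eq_square)
    ultimately show ?thesis by simp
  qed (use y in simp)
  show ?thesis using le[OF assms] le[of "adj A x"] assms by simp
qed

section \<open>Norm limits and completeness\<close>

definition lim_to :: "(nat \<Rightarrow> 'a) \<Rightarrow> 'a \<Rightarrow> bool" where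
  "lim_to f l \<longleftrightarrow> (\<lambda>n. cnorm A (f n \<ominus> l)) \<longlonglongrightarrow> 0"

lemma lim_to_bound:
  assumes "range f \<subseteq> carrier A" "l \<in> carrier A" "g \<longlonglongrightarrow> 0" "\<And>n. cnorm A (f n \<ominus> l) \<le> g n"
  shows "lim_to f l"
  unfolding lim_to_def
proof (rule tendsto_sandwich[OF _ _ tendsto_const assms(3)])
  have "f n \<in> carrier A" for n using assms(1) by auto
  then show "\<forall>\<^sub>F n in sequentially. 0 \<le> cnorm A (f n \<ominus> l)" using assms(2) by simp
  show "\<forall>\<^sub>F n in sequentially. cnorm A (f n \<ominus> l) \<le> g n" using assms(4) by simp
qed

lemma lim_to_unique:
  assumes f: "\<And>n. f n \<in> carrier A" and l: "l \<in> carrier A" "l' \<in> carrier A"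
    and "lim_to f l" "lim_to f l'"
  shows "l = l'"
proof -
  have "(\<lambda>n. cnorm A (f n \<ominus> l) + cnorm A (f n \<ominus> l')) \<longlonglongrightarrow> 0 + 0"
    using assms(4,5) unfolding lim_to_def by (rule tendsto_add)
  moreover have "cnorm A (l \<ominus> l') \<le> cnorm A (f n \<ominus> l) + cnorm A (f n \<ominus> l')" for n
    using cnorm_diff_triangle[of l "f n" l'] f l by (simp add: cnorm_diff_comm)
  ultimately have "cnorm A (l \<ominus> l') \<le> 0"
    using LIMSEQ_le_const[of _ 0 "cnorm A (l \<ominus> l')"] by simp
  then have "l \<ominus> l' = \<zero>"
    using l cnorm_nonneg[of "l \<ominus> l'"] cnorm_eq_zero[of "l \<ominus> l'"] by (simp del: cnorm_nonneg)
  then show ?thesis using l by (simp add: diff_eq_zero)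
qed

lemma lim_to_const: "x \<in> carrier A \<Longrightarrow> lim_to (\<lambda>_. x) x"
  by (simp add: lim_to_def)

lemma lim_to_Suc: "lim_to f l \<Longrightarrow> lim_to (\<lambda>n. f (Suc n)) l"
  unfolding lim_to_def by (rule LIMSEQ_Suc)

lemma lim_to_add:
  assumes f: "\<And>n. f n \<in> carrier A" "\<And>n. g n \<in> carrier A" and l: "l \<in> carrier A" "l' \<in> carrier A"
    and "lim_to f l" "lim_to g l'"
  shows "lim_to (\<lambda>n. f n \<oplus> g n) (l \<oplus> l')"
proof (rule lim_to_bound)
  show "(\<lambda>n. cnorm A (f n \<ominus> l) + cnorm A (g n \<ominus> l')) \<longlonglongrightarrow> 0"
    using tendsto_add[OF assms(5,6)[unfolded lim_to_def]] by simp
  show "cnorm A (f n \<oplus> g n \<ominus> (l \<oplus> l')) \<le> cnorm A (f n \<ominus> l) + cnorm A (g n \<ominus> l')" for n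
    using f l by (simp add: add_diff_add cnorm_triangle)
qed (use f l in auto)

lemma lim_to_smult:
  assumes f: "\<And>n. f n \<in> carrier A" and l: "l \<in> carrier A" and "lim_to f l"
  shows "lim_to (\<lambda>n. c \<odot>\<^bsub>A\<^esub> f n) (c \<odot>\<^bsub>A\<^esub> l)"
proof (rule lim_to_bound)
  show "(\<lambda>n. cmod c * cnorm A (f n \<ominus> l)) \<longlonglongrightarrow> 0"
    using tendsto_mult_right_zero[OF assms(3)[unfolded lim_to_def]] .
  show "cnorm A (c \<odot>\<^bsub>A\<^esub> f n \<ominus> c \<odot>\<^bsub>A\<^esub> l) \<le> cmod c * cnorm A (f n \<ominus> l)" for n
    using f l by (simp add: smult_diff[symmetric] cnorm_smult)
qed (use f l in auto)

lemma lim_to_adj: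
  assumes f: "\<And>n. f n \<in> carrier A" and l: "l \<in> carrier A" and "lim_to f l"
  shows "lim_to (\<lambda>n. adj A (f n)) (adj A l)"
  using assms by (simp add: lim_to_def adj_diff[symmetric])

lemma lim_to_mult_const:
  assumes f: "\<And>n. f n \<in> carrier A" and l: "l \<in> carrier A" "x \<in> carrier A" and "lim_to f l"
  shows "lim_to (\<lambda>n. f n \<otimes> x) (l \<otimes> x)"
proof (rule lim_to_bound)
  show "(\<lambda>n. cnorm A (f n \<ominus> l) * cnorm A x) \<longlonglongrightarrow> 0"
    using tendsto_mult_left_zero[OF assms(4)[unfolded lim_to_def]] .
  show "cnorm A (f n \<otimes> x \<ominus> l \<otimes> x) \<le> cnorm A (f n \<ominus> l) * cnorm A x" for n
    using f l by (simp add: diff_mult[symmetric] cnorm_mult)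
qed (use f l in auto)

lemma lim_to_const_mult:
  assumes f: "\<And>n. f n \<in> carrier A" and l: "l \<in> carrier A" "x \<in> carrier A" and "lim_to f l"
  shows "lim_to (\<lambda>n. x \<otimes> f n) (x \<otimes> l)"
proof (rule lim_to_bound)
  show "(\<lambda>n. cnorm A x * cnorm A (f n \<ominus> l)) \<longlonglongrightarrow> 0"
    using tendsto_mult_right_zero[OF assms(4)[unfolded lim_to_def]] .
  show "cnorm A (x \<otimes> f n \<ominus> x \<otimes> l) \<le> cnorm A x * cnorm A (f n \<ominus> l)" for n
    using f l by (simp add: mult_diff[symmetric] cnorm_mult)
qed (use f l in auto)

text \<open>Form of completeness behind two constructions: the square root of 1 - x and the exact
  lift of an element of the closure of a range.\<close>

lemma lim_to_geometric:
  assumes f: "\<And>n. f n \<in> carrier A" and q: "0 \<le> q" "q < 1"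
    and step: "\<And>n. cnorm A (f (Suc n) \<ominus> f n) \<le> K * q ^ n"
  shows "\<exists>l\<in>carrier A. lim_to f l"
  unfolding lim_to_def
proof (rule complete)
  show "range f \<subseteq> carrier A" using f by auto
  fix \<epsilon> :: real assume \<epsilon>: "\<epsilon> > 0"
  have "0 \<le> K" using order_trans[OF cnorm_nonneg step[of 0]] f by simp
  \<comment> \<open>The exact partial geometric sum closes the induction on k; the factor
    \<open>1 - q ^ k\<close> is dropped only afterwards.\<close>
  have tail: "cnorm A (f (n + k) \<ominus> f n) \<le> K * q ^ n * (1 - q ^ k) / (1 - q)" for n k
  proof (induction k)
    case (Suc k)
    have "cnorm A (f (n + Suc k) \<ominus> f n) \<le> K * q ^ (n + k) + K * q ^ n * (1 - q ^ k) / (1 - q)"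
      using cnorm_diff_triangle[of "f (Suc (n + k))" "f (n + k)" "f n"] f step[of "n + k"] Suc by simp
    also have "\<dots> = K * q ^ n * (1 - q ^ Suc k) / (1 - q)"
      using q by (simp add: field_simps power_add)
    finally show ?case .
  qed (use f in simp)
  have tail': "cnorm A (f (n + k) \<ominus> f n) \<le> K / (1 - q) * q ^ n" for n k
  proof (rule order_trans[OF tail])
    have "K * q ^ n * (1 - q ^ k) \<le> K * q ^ n * 1"
      using \<open>0 \<le> K\<close> q by (intro mult_left_mono) simp_all
    then show "K * q ^ n * (1 - q ^ k) / (1 - q) \<le> K / (1 - q) * q ^ n"
      using q by (simp add: divide_right_mono)
  qed
  have "(\<lambda>n. K / (1 - q) * q ^ n) \<longlonglongrightarrow> 0"
    using q by (intro tendsto_mult_right_zero LIMSEQ_realpow_zero)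
  from order_tendstoD(2)[OF this \<epsilon>]
  obtain N where N: "\<And>n. n \<ge> N \<Longrightarrow> K / (1 - q) * q ^ n < \<epsilon>"
    unfolding eventually_sequentially by blast
  have *: "cnorm A (f m \<ominus> f n) < \<epsilon>" if "N \<le> n" "n \<le> m" for m n
    using le_less_trans[OF tail'[of n "m - n"] N[OF that(1)]] that by simp
  show "\<exists>N. \<forall>m\<ge>N. \<forall>n\<ge>N. cnorm A (f m \<ominus> f n) < \<epsilon>"
  proof (intro exI allI impI)
    fix m n assume "N \<le> m" "N \<le> n"
    then show "cnorm A (f m \<ominus> f n) < \<epsilon>"
      using *[of n m] *[of m n] cnorm_diff_comm[of "f m" "f n"] f by (cases "n \<le> m") simp_all
  qed
qed

lemma cstar_subalgebraI:
  assumes "B \<subseteq> carrier A" "\<zero> \<in> B" "\<And>x y. \<lbrakk>x \<in> B; y \<in> B\<rbrakk> \<Longrightarrow> x \<oplus> y \<in> B"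
    "\<And>c x. x \<in> B \<Longrightarrow> c \<odot>\<^bsub>A\<^esub> x \<in> B" "\<And>x y. \<lbrakk>x \<in> B; y \<in> B\<rbrakk> \<Longrightarrow> x \<otimes> y \<in> B"
    "\<And>x. x \<in> B \<Longrightarrow> adj A x \<in> B"
    "\<And>f l. \<lbrakk>l \<in> carrier A; \<And>n. f n \<in> B; lim_to f l\<rbrakk> \<Longrightarrow> l \<in> B"
  shows "cstar_subalgebra A B"
  unfolding cstar_subalgebra_def lim_to_def[symmetric]
  by (intro conjI ballI allI impI assms(1-6); (assumption | (rule assms(7); blast)))

text \<open>The elements with property \<open>P\<close> form a C*-subalgebra containing the
  generators, hence everything. This replaces approximation by words in the generators, at the price
  of a limit case in each application.\<close>

lemma generated_induct [consumes 2, case_names gen zero add smult mult adj lim]: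
  assumes "cstar_generated_by A X" "x \<in> carrier A"
    and "\<And>x. x \<in> X \<Longrightarrow> P x" "P \<zero>"
    and "\<And>x y. \<lbrakk>x \<in> carrier A; y \<in> carrier A; P x; P y\<rbrakk> \<Longrightarrow> P (x \<oplus> y)"
    and "\<And>c x. \<lbrakk>x \<in> carrier A; P x\<rbrakk> \<Longrightarrow> P (c \<odot>\<^bsub>A\<^esub> x)"
    and "\<And>x y. \<lbrakk>x \<in> carrier A; y \<in> carrier A; P x; P y\<rbrakk> \<Longrightarrow> P (x \<otimes> y)"
    and "\<And>x. \<lbrakk>x \<in> carrier A; P x\<rbrakk> \<Longrightarrow> P (adj A x)"
    and "\<And>f l. \<lbrakk>\<And>n. f n \<in> carrier A; l \<in> carrier A; \<And>n. P (f n); lim_to f l\<rbrakk> \<Longrightarrow> P l"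
  shows "P x"
proof -
  let ?B = "{x \<in> carrier A. P x}"
  have "cstar_subalgebra A ?B"
  proof (rule cstar_subalgebraI)
    show "l \<in> ?B" if "l \<in> carrier A" "\<And>n. f n \<in> ?B" "lim_to f l" for f l
      using assms(9)[of f l] that by simp
  qed (simp_all add: assms(4-8))
  moreover have "X \<subseteq> ?B" using assms(1,3) unfolding cstar_generated_by_def by auto
  ultimately have "?B = carrier A" using assms(1) unfolding cstar_generated_by_def by blast
  with assms(2) show ?thesis by blast
qed

text \<open>Expand \<open>(z - z\<^sup>*z)\<^sup>*(z - z\<^sup>*z)\<close>.\<close>

lemma idempotent_partial_isometry_selfadjoint:
  assumes z: "z \<in> carrier A" and "z \<otimes> z = z" and "z \<otimes> adj A z \<otimes> z = z"
  shows "adj A z = z"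
proof -
  let ?p = "adj A z \<otimes> z"
  have 1: "adj A z \<otimes> ?p = ?p"
    using z assms(2) adj_mult[of z z] by (simp add: mult_assoc[symmetric])
  have 2: "?p \<otimes> z = ?p" using z assms(2) by (simp add: mult_assoc)
  have 3: "?p \<otimes> ?p = ?p" using z assms(3) by (simp add: mult_assoc)
  have 4: "adj A ?p = ?p" using z by (simp add: adj_mult)
  have "adj A (z \<ominus> ?p) \<otimes> (z \<ominus> ?p) = \<zero>"
    using z by (simp add: adj_diff 4 diff_mult mult_diff 1 2 3)
  then have "z \<ominus> ?p = \<zero>" by (rule adj_mult_self_eq_zero[rotated]) (use z in simp)
  then have "z = ?p" by (subst (asm) diff_eq_zero) (use z in simp_all)
  with 4 show ?thesis by simp
qed

text \<open>The idempotents ab and ba are partial isometries, hence projections. Taking adjoints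
  gives a*a = ba and aa* = ab, so that b = bab = a*aa* = a*. For images of elements of an inverse
  semigroup the last two hypotheses hold because products are again such images.\<close>

lemma partial_isometry_inverse_eq_adj:
  assumes a: "a \<in> carrier A" "b \<in> carrier A" and "a \<otimes> b \<otimes> a = a" "b \<otimes> a \<otimes> b = b"
    and "a \<otimes> adj A a \<otimes> a = a"
    and ab: "a \<otimes> b \<otimes> adj A (a \<otimes> b) \<otimes> (a \<otimes> b) = a \<otimes> b"
    and ba: "b \<otimes> a \<otimes> adj A (b \<otimes> a) \<otimes> (b \<otimes> a) = b \<otimes> a"
  shows "b = adj A a"
proof -
  have sab: "adj A (a \<otimes> b) = a \<otimes> b"
    by (rule idempotent_partial_isometry_selfadjoint) (use assms in \<open>simp_all add: mult_assoc[symmetric]\<close>)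
  have sba: "adj A (b \<otimes> a) = b \<otimes> a"
    by (rule idempotent_partial_isometry_selfadjoint) (use assms in \<open>simp_all add: mult_assoc[symmetric]\<close>)
  have "b \<otimes> a \<otimes> (adj A a \<otimes> a) = b \<otimes> a"
    using assms(5) a by (simp add: mult_assoc)
  then have "adj A a \<otimes> a \<otimes> (b \<otimes> a) = b \<otimes> a"
    \<comment> \<open>Adjoints of both sides: \<open>b \<otimes> a\<close> and
      \<open>adj A a \<otimes> a\<close> are self-adjoint, so the order of the factors is
      reversed.\<close>
    using a sba by (metis adj_adj adj_mult adj_closed mult_closed)
  moreover have "adj A a \<otimes> a \<otimes> (b \<otimes> a) = adj A a \<otimes> a"
    using assms(3) a by (simp add: mult_assoc)
  ultimately have 1: "adj A a \<otimes> a = b \<otimes> a" by simp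
  have "a \<otimes> adj A a \<otimes> (a \<otimes> b) = a \<otimes> b"
    using assms(5) a by (simp add: mult_assoc[symmetric])
  then have "a \<otimes> b \<otimes> (a \<otimes> adj A a) = a \<otimes> b"
    using a sab by (metis adj_adj adj_mult adj_closed mult_closed)
  moreover have "a \<otimes> b \<otimes> (a \<otimes> adj A a) = a \<otimes> adj A a"
    using assms(3) a by (simp add: mult_assoc[symmetric])
  ultimately have 2: "a \<otimes> adj A a = a \<otimes> b" by simp
  have "b = adj A a \<otimes> (a \<otimes> adj A a)"
    using 1 2 assms(4) a by (simp add: mult_assoc[symmetric])
  also have "\<dots> = adj A (a \<otimes> adj A a \<otimes> a)"
    using a by (simp add: adj_mult mult_assoc)
  finally show ?thesis using assms(5) by simp
qed

end

section \<open>Square roots, unitaries and the cubic Chebyshev polynomial\<close>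

context unital_cstar_algebra
begin

lemmas [simp] = unit_closed unit_l unit_r

lemma adj_unit [simp]: "adj A \<one> = \<one>"
  using unit_l[of "adj A \<one>"] adj_mult[of "adj A \<one>" \<one>] by simp

text \<open>The C*-identity makes the norm of the unit equal to its own square, so it is 0 or 1; the
  value 0 occurs in the zero algebra.\<close>

lemma cnorm_unit_le: "cnorm A \<one> \<le> 1"
proof -
  have "(cnorm A \<one>)\<^sup>2 = cnorm A \<one>" using cstar_identity[of \<one>] by simp
  then show ?thesis by (metis order_refl power2_eq_square mult_cancel_right1 zero_le_one)
qed

lemma cnorm_isometry_le: "\<lbrakk>u \<in> carrier A; adj A u \<otimes> u = \<one>\<rbrakk> \<Longrightarrow> cnorm A u \<le> 1"
  using cstar_identity[of u] cnorm_unit_le by (metis power2_le_imp_le one_power2 zero_le_one)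

text \<open>
  The map \<open>y \<mapsto> (x + y\<^sup>2) / 2\<close> is a contraction of the ball of radius \<open>\<parallel>x\<parallel>\<close>, and its fixed
  point is \<open>1 - (1 - x)\<^sup>1\<^sup>/\<^sup>2\<close>.
\<close>

lemma sqrt_one_minus:
  assumes x: "x \<in> carrier A" "adj A x = x" "cnorm A x < 1"
  obtains y where "y \<in> carrier A" "adj A y = y" "y \<otimes> y = \<one> \<ominus> x"
    "\<And>h. h \<in> carrier A \<Longrightarrow> h \<otimes> x = x \<otimes> h \<Longrightarrow> h \<otimes> y = y \<otimes> h"
proof -
  define r where "r = cnorm A x"
  have r: "0 \<le> r" "r < 1" using x by (auto simp: r_def)
  define F where "F y = (1/2) \<odot>\<^bsub>A\<^esub> (x \<oplus> y \<otimes> y)" for y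
  define f where "f n = (F ^^ n) \<zero>" for n
  have f0 [simp]: "f 0 = \<zero>" and fS: "f (Suc n) = (1/2) \<odot>\<^bsub>A\<^esub> (x \<oplus> f n \<otimes> f n)" for n
    by (simp_all add: f_def F_def)
  have fc [simp]: "f n \<in> carrier A" for n by (induction n) (use x in \<open>simp_all add: fS\<close>)
  have fa: "adj A (f n) = f n" for n
    by (induction n) (use x in \<open>simp_all add: fS adj_smult adj_add adj_mult\<close>)
  have fr: "cnorm A (f n) \<le> r" for n
  proof (induction n)
    case (Suc n)
    have "cnorm A (f (Suc n)) \<le> (1/2) * (r + cnorm A (f n) * cnorm A (f n))"
      using cnorm_triangle[of x "f n \<otimes> f n"] cnorm_mult[of "f n" "f n"] x
      by (simp add: fS cnorm_smult r_def)
    also have "cnorm A (f n) * cnorm A (f n) \<le> r * 1"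
      using Suc r by (intro mult_mono) simp_all
    finally show ?case by simp
  qed (use r in simp)
  \<comment> \<open>The order of the factors is kept, so that no commutation of the iterates
    enters.\<close>
  have ff: "f n \<otimes> f n \<ominus> f m \<otimes> f m = f n \<otimes> (f n \<ominus> f m) \<oplus> (f n \<ominus> f m) \<otimes> f m" for n m
    by (simp add: mult_diff diff_mult diff_add_diff)
  have ffn: "cnorm A (f n \<otimes> f n \<ominus> f m \<otimes> f m) \<le> 2 * r * cnorm A (f n \<ominus> f m)" for n m
  proof -
    have "cnorm A (f n \<otimes> f n \<ominus> f m \<otimes> f m)
      \<le> cnorm A (f n) * cnorm A (f n \<ominus> f m) + cnorm A (f n \<ominus> f m) * cnorm A (f m)"
      unfolding ff by (rule order_trans[OF cnorm_triangle add_mono[OF cnorm_mult cnorm_mult]]) simp_all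
    also have "\<dots> \<le> r * cnorm A (f n \<ominus> f m) + cnorm A (f n \<ominus> f m) * r"
      by (intro add_mono mult_left_mono mult_right_mono fr) simp_all
    finally show ?thesis by simp
  qed
  \<comment> \<open>The factor 1/2 in the iteration cancels the 2 in \<open>ffn\<close>, which
    leaves the contraction factor r. Since \<open>f 0\<close> is zero, the first step has norm at
    most r.\<close>
  have "cnorm A (f (Suc n) \<ominus> f n) \<le> r * r ^ n" for n
  proof (induction n)
    case 0 show ?case using fr[of "Suc 0"] by simp
  next
    case (Suc n)
    have "f (Suc (Suc n)) \<ominus> f (Suc n) = (1/2) \<odot>\<^bsub>A\<^esub> (f (Suc n) \<otimes> f (Suc n) \<ominus> f n \<otimes> f n)"
      using x by (simp add: fS[of "Suc n"] fS[of n] smult_diff[symmetric] add_diff_add del: fS)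
    then have "cnorm A (f (Suc (Suc n)) \<ominus> f (Suc n)) \<le> r * cnorm A (f (Suc n) \<ominus> f n)"
      using ffn[of "Suc n" n] by (simp add: cnorm_smult)
    also have "\<dots> \<le> r * (r * r ^ n)" using Suc r by (intro mult_left_mono) simp_all
    finally show ?case by simp
  qed
  then obtain l where l: "l \<in> carrier A" "lim_to f l"
    using lim_to_geometric[of f r r] r fc by auto
  have lr: "adj A l = l"
    using lim_to_unique[OF fc _ l(1), of "adj A l"] lim_to_adj[OF fc l] l by (simp add: fa)
  have sq: "lim_to (\<lambda>n. f n \<otimes> f n) (l \<otimes> l)"
  proof (rule lim_to_bound)
    \<comment> \<open>The crude constant \<open>r + cnorm A l\<close> spares a proof that the limit
      stays in the ball of radius r.\<close>
    show "(\<lambda>n. (r + cnorm A l) * cnorm A (f n \<ominus> l)) \<longlonglongrightarrow> 0"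
      using l(2) unfolding lim_to_def by (rule tendsto_mult_right_zero)
    fix n
    have eq: "f n \<otimes> f n \<ominus> l \<otimes> l = f n \<otimes> (f n \<ominus> l) \<oplus> (f n \<ominus> l) \<otimes> l"
      using l by (simp add: mult_diff diff_mult diff_add_diff)
    have "cnorm A (f n \<otimes> f n \<ominus> l \<otimes> l)
      \<le> cnorm A (f n) * cnorm A (f n \<ominus> l) + cnorm A (f n \<ominus> l) * cnorm A l"
      unfolding eq by (rule order_trans[OF cnorm_triangle add_mono[OF cnorm_mult cnorm_mult]])
        (use l in simp_all)
    also have "\<dots> \<le> r * cnorm A (f n \<ominus> l) + cnorm A (f n \<ominus> l) * cnorm A l"
      by (intro add_mono mult_left_mono mult_right_mono fr) (use l in simp_all)
    finally show "cnorm A (f n \<otimes> f n \<ominus> l \<otimes> l) \<le> (r + cnorm A l) * cnorm A (f n \<ominus> l)"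
      by (simp add: algebra_simps)
  qed (use l in auto)
  have "lim_to (\<lambda>n. f (Suc n)) ((1/2) \<odot>\<^bsub>A\<^esub> (x \<oplus> l \<otimes> l))"
    unfolding fS using x l sq by (intro lim_to_smult lim_to_add lim_to_const) simp_all
  then have fp: "l = (1/2) \<odot>\<^bsub>A\<^esub> (x \<oplus> l \<otimes> l)"
    by (rule lim_to_unique[OF _ _ _ lim_to_Suc[OF l(2)], rotated -1]) (use l x in simp_all)
  have fp2: "l \<oplus> l = x \<oplus> l \<otimes> l"
  proof -
    have "2 \<odot>\<^bsub>A\<^esub> l = 2 \<odot>\<^bsub>A\<^esub> ((1/2) \<odot>\<^bsub>A\<^esub> (x \<oplus> l \<otimes> l))" using fp by (rule arg_cong)
    also have "\<dots> = x \<oplus> l \<otimes> l" using l x by simp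
    finally have "2 \<odot>\<^bsub>A\<^esub> l = x \<oplus> l \<otimes> l" .
    then show ?thesis using smult_add_left[of l 1 1] l by simp
  qed
  \<comment> \<open>Commutation with x passes to every iterate and then to the limit.\<close>
  have comm: "h \<otimes> l = l \<otimes> h" if h: "h \<in> carrier A" "h \<otimes> x = x \<otimes> h" for h
  proof -
    have "h \<otimes> f n = f n \<otimes> h" for n
    proof (induction n)
      case (Suc n)
      have "h \<otimes> (f n \<otimes> f n) = f n \<otimes> f n \<otimes> h"
        using h by (metis Suc fc mult_assoc)
      then show ?case using h x Suc
        by (simp add: fS smult_mult_l smult_mult_r mult_l_distr mult_r_distr)
    qed (use h in simp)
    then show ?thesis
      using lim_to_unique[of "\<lambda>n. f n \<otimes> h" "h \<otimes> l" "l \<otimes> h"]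
        lim_to_const_mult[of f l h] lim_to_mult_const[of f l h] l h by simp
  qed
  show thesis
  proof (rule that[of "\<one> \<ominus> l"])
    have "(\<one> \<ominus> l) \<otimes> (\<one> \<ominus> l) = (\<one> \<ominus> l) \<ominus> (l \<ominus> l \<otimes> l)"
      using l by (simp add: diff_mult mult_diff)
    also have "\<dots> = \<one> \<oplus> (-1) \<odot>\<^bsub>A\<^esub> (l \<oplus> l) \<oplus> l \<otimes> l"
      using l by (simp add: diff_smult smult_add_right a_assoc)
    also have "\<dots> = \<one> \<ominus> x \<oplus> (l \<otimes> l \<ominus> l \<otimes> l)"
      unfolding fp2 using l x by (simp add: diff_smult smult_add_right a_ac del: diff_self)
    finally show "(\<one> \<ominus> l) \<otimes> (\<one> \<ominus> l) = \<one> \<ominus> x" using l x by simp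
    show "adj A (\<one> \<ominus> l) = \<one> \<ominus> l" using l lr by (simp add: adj_diff)
    show "h \<otimes> (\<one> \<ominus> l) = (\<one> \<ominus> l) \<otimes> h" if "h \<in> carrier A" "h \<otimes> x = x \<otimes> h" for h
      using comm[OF that] that l by (simp add: diff_mult mult_diff)
  qed (use l in simp)
qed

text \<open>With h = c/2 and k the root of 1 - h^2, the unitary is u = h + ik, modelled on cos x + i
  sin x. Since h and k are self-adjoint and commute, u*u and uu* both reduce to h^2 + k^2 = 1. The
  strict bound on c puts the norm of h^2 below 1, where the root is available.\<close>

lemma selfadjoint_eq_unitary_add_adj:
  assumes c: "c \<in> carrier A" "adj A c = c" "cnorm A c < 2"
  obtains u where "u \<in> carrier A" "adj A u \<otimes> u = \<one>" "u \<otimes> adj A u = \<one>" "c = u \<oplus> adj A u"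
proof -
  define h where "h = (1/2) \<odot>\<^bsub>A\<^esub> c"
  have h [simp]: "h \<in> carrier A" "adj A h = h" using c by (simp_all add: h_def adj_smult)
  have hn: "cnorm A h < 1" using c by (simp add: h_def cnorm_smult)
  have "cnorm A (h \<otimes> h) = (cnorm A h)\<^sup>2" using cstar_identity[of h] by simp
  also have "\<dots> < 1" using hn by (simp add: power_less_one_iff abs_square_less_1)
  finally have hh: "cnorm A (h \<otimes> h) < 1" .
  have ha: "adj A (h \<otimes> h) = h \<otimes> h" by (simp add: adj_mult)
  obtain k where k: "k \<in> carrier A" "adj A k = k" "k \<otimes> k = \<one> \<ominus> h \<otimes> h"
    and kc: "\<And>g. g \<in> carrier A \<Longrightarrow> g \<otimes> (h \<otimes> h) = h \<otimes> h \<otimes> g \<Longrightarrow> g \<otimes> k = k \<otimes> g"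
    by (rule sqrt_one_minus[OF mult_closed[OF h(1) h(1)] ha hh]) (rule that)
  have comm: "h \<otimes> k = k \<otimes> h" by (rule kc) (simp_all add: mult_assoc)
  have one: "h \<otimes> h \<oplus> k \<otimes> k = \<one>"
    unfolding k(3) by (simp add: a_comm[of "h \<otimes> h"])
  define u where "u = h \<oplus> \<i> \<odot>\<^bsub>A\<^esub> k"
  have au: "adj A u = h \<oplus> (-\<i>) \<odot>\<^bsub>A\<^esub> k" using k by (simp add: u_def adj_add adj_smult)
  \<comment> \<open>In the right-nested expansion of the two products, the cross terms stand next to
    each other in exactly this shape.\<close>
  have cancel: "a \<odot>\<^bsub>A\<^esub> y \<oplus> ((-a) \<odot>\<^bsub>A\<^esub> y \<oplus> w) = w"
    if "y \<in> carrier A" "w \<in> carrier A" for a y w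
    using that smult_add_left[of y a "-a"] by (simp add: a_assoc[symmetric])
  have "adj A u \<otimes> u = \<one>" "u \<otimes> adj A u = \<one>"
    unfolding au unfolding u_def using k(1) one comm cancel[of "k \<otimes> h" "k \<otimes> k" "\<i>"]
      cancel[of "k \<otimes> h" "k \<otimes> k" "-\<i>"]
    by (simp_all add: mult_l_distr mult_r_distr smult_mult_l smult_mult_r smult_add_right a_assoc)
  moreover have "u \<oplus> adj A u = c"
  proof -
    have "u \<oplus> adj A u = h \<oplus> h \<oplus> (\<i> \<odot>\<^bsub>A\<^esub> k \<oplus> (-\<i>) \<odot>\<^bsub>A\<^esub> k)"
      unfolding au unfolding u_def using k(1) by (simp add: a_ac)
    also have "\<dots> = c"
      using c k(1) smult_add_left[of c "1/2" "1/2"] smult_add_left[of k \<i> "-\<i>"] by (simp add: h_def)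
    finally show ?thesis .
  qed
  ultimately show thesis using that[of u] k(1) by (simp add: u_def)
qed

text \<open>For c = u + u* the cubic equals u^3 + u*^3, as 2 cos 3x = (2 cos x)^3 - 3 (2 cos x), and
  each cube has norm at most 1.\<close>

lemma cnorm_cubic_le:
  assumes c: "c \<in> carrier A" "adj A c = c" "cnorm A c < 2"
  shows "cnorm A (c \<otimes> c \<otimes> c \<ominus> 3 \<odot>\<^bsub>A\<^esub> c) \<le> 2"
proof -
  obtain u where u: "u \<in> carrier A" "adj A u \<otimes> u = \<one>" "u \<otimes> adj A u = \<one>" "c = u \<oplus> adj A u"
    using selfadjoint_eq_unitary_add_adj[OF c] by metis
  define w where "w = adj A u"
  have w: "w \<in> carrier A" "w \<otimes> u = \<one>" "u \<otimes> w = \<one>" "c = u \<oplus> w" "adj A w \<otimes> w = \<one>"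
    using u by (simp_all add: w_def)
  have "u \<otimes> u \<otimes> w = u" "w \<otimes> w \<otimes> u = w" using u(1) w by (simp_all add: mult_assoc)
  \<comment> \<open>Of the eight words in u and w, the six mixed ones reduce to three copies of u
    and three of w, since uw = wu = 1.\<close>
  then have "c \<otimes> c \<otimes> c = (u \<otimes> u \<otimes> u \<oplus> w \<otimes> w \<otimes> w) \<oplus> (c \<oplus> c \<oplus> c)"
    unfolding w(4) using u(1) w(1-3) by (simp add: mult_l_distr mult_r_distr a_ac)
  moreover have "3 \<odot>\<^bsub>A\<^esub> c = c \<oplus> c \<oplus> c"
    using smult_add_left[of c 2 1] smult_add_left[of c 1 1] c by simp
  ultimately have eq: "c \<otimes> c \<otimes> c \<ominus> 3 \<odot>\<^bsub>A\<^esub> c = u \<otimes> u \<otimes> u \<oplus> w \<otimes> w \<otimes> w"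
    using c(1) u(1) w(1) by (simp add: minus_eq a_assoc r_neg)
  have cube: "cnorm A (x \<otimes> x \<otimes> x) \<le> 1" if x: "x \<in> carrier A" "cnorm A x \<le> 1" for x
  proof -
    have "cnorm A (x \<otimes> x \<otimes> x) \<le> cnorm A x * cnorm A x * cnorm A x"
      using x cnorm_mult[of "x \<otimes> x" x] cnorm_mult[of x x]
      by (meson cnorm_nonneg mult_closed mult_right_mono order_trans)
    also have "\<dots> \<le> 1" using x by (simp add: mult_le_one)
    finally show ?thesis .
  qed
  show ?thesis unfolding eq
    using cnorm_triangle[of "u \<otimes> u \<otimes> u" "w \<otimes> w \<otimes> w"] cube[of u] cube[of w]
      cnorm_isometry_le[of u] cnorm_isometry_le[of w] u(1,2) w(1,5) by simp
qed

text \<open>With c = 2h/R the expression is -R/6 times c^3 - 3c, and that cubic has norm at most 2.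
  This is the origin of the coefficient 4/(3 R^2).\<close>

lemma cnorm_reduce_le:
  assumes h: "h \<in> carrier A" "adj A h = h" "cnorm A h < R"
  shows "cnorm A (h \<ominus> complex_of_real (4 / (3 * R\<^sup>2)) \<odot>\<^bsub>A\<^esub> (h \<otimes> h \<otimes> h)) \<le> R / 3"
proof -
  have R: "R > 0" using h cnorm_nonneg[of h] by linarith
  define c where "c = complex_of_real (2 / R) \<odot>\<^bsub>A\<^esub> h"
  have c: "c \<in> carrier A" "adj A c = c" "cnorm A c < 2"
    using h R by (simp_all add: c_def adj_smult cnorm_smult norm_divide field_simps)
  have "h \<ominus> complex_of_real (4 / (3 * R\<^sup>2)) \<odot>\<^bsub>A\<^esub> (h \<otimes> h \<otimes> h)
    = complex_of_real (- R / 6) \<odot>\<^bsub>A\<^esub> (c \<otimes> c \<otimes> c \<ominus> 3 \<odot>\<^bsub>A\<^esub> c)"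
    using h(1) R by (simp add: c_def diff_smult smult_add_right smult_mult_l smult_mult_r
        mult_assoc a_comm power2_eq_square field_simps)
  then show ?thesis using cnorm_cubic_le[OF c] c(1) R by (simp add: cnorm_smult norm_divide)
qed

end

section \<open>Homomorphisms between unital C*-algebras\<close>

locale unital_star_hom =
  A: unital_cstar_algebra A + B: unital_cstar_algebra B
  for A :: "'a cstar" and B :: "'b cstar" and \<eta> :: "'a \<Rightarrow> 'b" +
  assumes star_hom: "star_hom A B \<eta>"
    and hom_unit [simp]: "\<eta> \<one>\<^bsub>A\<^esub> = \<one>\<^bsub>B\<^esub>"
begin

lemma hom_closed [simp]: "x \<in> carrier A \<Longrightarrow> \<eta> x \<in> carrier B"
  and hom_add: "\<lbrakk>x \<in> carrier A; y \<in> carrier A\<rbrakk> \<Longrightarrow> \<eta> (x \<oplus>\<^bsub>A\<^esub> y) = \<eta> x \<oplus>\<^bsub>B\<^esub> \<eta> y"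
  and hom_smult: "x \<in> carrier A \<Longrightarrow> \<eta> (c \<odot>\<^bsub>A\<^esub> x) = c \<odot>\<^bsub>B\<^esub> \<eta> x"
  and hom_mult: "\<lbrakk>x \<in> carrier A; y \<in> carrier A\<rbrakk> \<Longrightarrow> \<eta> (x \<otimes>\<^bsub>A\<^esub> y) = \<eta> x \<otimes>\<^bsub>B\<^esub> \<eta> y"
  and hom_adj: "x \<in> carrier A \<Longrightarrow> \<eta> (adj A x) = adj B (\<eta> x)"
  using star_hom unfolding star_hom_def by auto

lemma hom_diff: "\<lbrakk>x \<in> carrier A; y \<in> carrier A\<rbrakk> \<Longrightarrow> \<eta> (x \<ominus>\<^bsub>A\<^esub> y) = \<eta> x \<ominus>\<^bsub>B\<^esub> \<eta> y"
  by (simp add: A.diff_smult B.diff_smult hom_add hom_smult)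

lemma hom_zero [simp]: "\<eta> \<zero>\<^bsub>A\<^esub> = \<zero>\<^bsub>B\<^esub>"
  using hom_smult[of "\<zero>\<^bsub>A\<^esub>" 0] by simp

text \<open>A self-adjoint \<open>x\<close> of norm below \<open>2\<close> is \<open>u + u\<^sup>*\<close> with \<open>u\<close> unitary, and \<open>\<eta> u\<close> is again unitary.\<close>

lemma hom_contractive_selfadjoint:
  assumes x: "x \<in> carrier A" "adj A x = x"
  shows "cnorm B (\<eta> x) \<le> cnorm A x"
proof (rule field_le_epsilon)
  fix \<epsilon> :: real assume "\<epsilon> > 0"
  \<comment> \<open>The margin \<epsilon> makes the rescaled element have norm strictly below 2, as
    the decomposition into unitaries demands.\<close>
  define t where "t = cnorm A x + \<epsilon>"
  have t: "t > 0" "cnorm A x < t"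
    using \<open>\<epsilon> > 0\<close> A.cnorm_nonneg[OF x(1)] by (auto simp: t_def)
  define c where "c = complex_of_real (2 / t) \<odot>\<^bsub>A\<^esub> x"
  have c: "c \<in> carrier A" "adj A c = c" "cnorm A c < 2"
    using x t by (simp_all add: c_def A.adj_smult A.cnorm_smult norm_divide field_simps)
  obtain u where u: "u \<in> carrier A" "adj A u \<otimes>\<^bsub>A\<^esub> u = \<one>\<^bsub>A\<^esub>" "u \<otimes>\<^bsub>A\<^esub> adj A u = \<one>\<^bsub>A\<^esub>"
      "c = u \<oplus>\<^bsub>A\<^esub> adj A u"
    by (rule A.selfadjoint_eq_unitary_add_adj[OF c]) (rule that)
  have "adj B (\<eta> u) \<otimes>\<^bsub>B\<^esub> \<eta> u = \<one>\<^bsub>B\<^esub>"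
    using u(1,2) by (simp add: hom_adj[symmetric] hom_mult[symmetric])
  then have "cnorm B (\<eta> u) \<le> 1" by (rule B.cnorm_isometry_le[rotated]) (use u in simp)
  moreover have "\<eta> c = \<eta> u \<oplus>\<^bsub>B\<^esub> adj B (\<eta> u)"
    unfolding u(4) using u(1) by (simp add: hom_adj hom_add)
  ultimately have "cnorm B (\<eta> c) \<le> 2"
    using B.cnorm_triangle[of "\<eta> u" "adj B (\<eta> u)"] u(1) by simp
  moreover have "cnorm B (\<eta> c) = 2 / t * cnorm B (\<eta> x)"
    using t x by (simp add: c_def hom_smult B.cnorm_smult norm_divide)
  ultimately show "cnorm B (\<eta> x) \<le> cnorm A x + \<epsilon>"
    using t by (simp add: t_def field_simps)
qed

text \<open>The C*-identity on both sides reduces the claim to the self-adjoint element x*x.\<close>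

lemma hom_contractive:
  assumes x: "x \<in> carrier A"
  shows "cnorm B (\<eta> x) \<le> cnorm A x"
proof -
  have "(cnorm B (\<eta> x))\<^sup>2 = cnorm B (\<eta> (adj A x \<otimes>\<^bsub>A\<^esub> x))"
    using x B.cstar_identity[of "\<eta> x"] by (simp add: hom_adj hom_mult)
  also have "\<dots> \<le> cnorm A (adj A x \<otimes>\<^bsub>A\<^esub> x)"
    using x by (intro hom_contractive_selfadjoint) (simp_all add: A.adj_mult)
  also have "\<dots> = (cnorm A x)\<^sup>2" by (rule A.cstar_identity[OF x])
  finally show ?thesis by (rule power2_le_imp_le) (use x in simp)
qed

lemma hom_lim:
  assumes f: "\<And>n. f n \<in> carrier A" and l: "l \<in> carrier A" and "A.lim_to f l"
  shows "B.lim_to (\<lambda>n. \<eta> (f n)) (\<eta> l)"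
proof (rule B.lim_to_bound)
  show "(\<lambda>n. cnorm A (f n \<ominus>\<^bsub>A\<^esub> l)) \<longlonglongrightarrow> 0" using assms(3) by (simp add: A.lim_to_def)
  show "cnorm B (\<eta> (f n) \<ominus>\<^bsub>B\<^esub> \<eta> l) \<le> cnorm A (f n \<ominus>\<^bsub>A\<^esub> l)" for n
    using f l hom_contractive[of "f n \<ominus>\<^bsub>A\<^esub> l"] by (simp add: hom_diff)
qed (use f l in auto)

text \<open>
  The range is closed because elements of the range can be approximately lifted with control of
  the norm: \<open>h \<mapsto> h - 4 h\<^sup>3 / (3 R\<^sup>2)\<close> maps the self-adjoint ball of radius \<open>R\<close> into
  the one of radius \<open>R / 3\<close>, but hardly moves \<open>\<eta> h\<close> if that is small compared with \<open>R\<close>.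
  Halving the radius from a large value down to \<open>4\<close> costs a convergent geometric series.
\<close>

lemma bounded_approximate_lift:
  assumes "h \<in> carrier A" "adj A h = h" "cnorm A h < 4 * 2 ^ m"
    "cnorm B (\<eta> h) \<le> 3/2 + (1/3) * (1/4) ^ m"
  shows "\<exists>a\<in>carrier A. adj A a = a \<and> cnorm A a < 4 \<and>
    cnorm B (\<eta> a \<ominus>\<^bsub>B\<^esub> \<eta> h) \<le> (1/3) * (1 - (1/4) ^ m)"
  using assms
proof (induction m arbitrary: h)
  case 0
  then show ?case by (intro bexI[of _ h]) simp_all
next
  case (Suc m)
  \<comment> \<open>\<open>R\<close> is the radius allowed for h, and q = 16/R^2, so c has modulus
    q/12. The image of h has norm at most 2 and its cube at most 8, so the image moves by at most
    8q/12, which is below q. As (1/4)^m = 4q, the bound for the next stage is met by q/3 + q = 4q/3,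
    and the moves q of all stages sum to less than 1/3.\<close>
  define R :: real where "R = 4 * 2 ^ Suc m"
  define q :: real where "q = (1/4) ^ Suc m"
  have q: "0 < q" "q \<le> 1/4"
    using power_le_one[of "1/4 :: real" m] by (simp_all add: q_def)
  have qR: "1 / R\<^sup>2 = q / 16"
    by (simp add: R_def q_def power_mult_distrib power_divide power_mult[symmetric] power2_eq_square
        power_mult_distrib[symmetric])
  have qm: "(1/4 :: real) ^ m = 4 * q" by (simp add: q_def)
  define c where "c = complex_of_real (4 / (3 * R\<^sup>2))"
  have cmc: "cmod c = q / 12"
  proof -
    have "cmod c = 4 / 3 * (1 / R\<^sup>2)" unfolding c_def norm_of_real by simp
    then show ?thesis unfolding qR by simp
  qed
  let ?k = "h \<otimes>\<^bsub>A\<^esub> h \<otimes>\<^bsub>A\<^esub> h"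
  define g where "g = h \<ominus>\<^bsub>A\<^esub> c \<odot>\<^bsub>A\<^esub> ?k"
  have k: "?k \<in> carrier A" "adj A ?k = ?k"
    using Suc.prems by (simp_all add: A.adj_mult A.mult_assoc)
  have g: "g \<in> carrier A" "adj A g = g"
    using Suc.prems k unfolding g_def c_def by (simp_all add: A.adj_diff A.adj_smult)
  have "cnorm A g \<le> R / 3"
    unfolding g_def c_def using Suc.prems by (intro A.cnorm_reduce_le) (simp_all add: R_def)
  \<comment> \<open>The cubic divides the radius by 3, whereas the induction only asks for halving:
    R/3 < R/2.\<close>
  also have "\<dots> < 4 * 2 ^ m" by (simp add: R_def)
  finally have gn: "cnorm A g < 4 * 2 ^ m" .
  have hB: "cnorm B (\<eta> h) \<le> 2" using Suc.prems(4) q by (simp add: q_def)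
  have "cnorm B (\<eta> ?k) \<le> cnorm B (\<eta> h) * cnorm B (\<eta> h) * cnorm B (\<eta> h)"
    using Suc.prems(1) B.cnorm_mult[of "\<eta> h \<otimes>\<^bsub>B\<^esub> \<eta> h" "\<eta> h"] B.cnorm_mult[of "\<eta> h" "\<eta> h"]
    by (simp add: hom_mult) (meson B.cnorm_nonneg hom_closed mult_right_mono order_trans)
  also have "\<dots> \<le> 2 * 2 * 2"
    using Suc.prems(1) hB by (intro mult_mono) simp_all
  finally have k8: "cnorm B (\<eta> ?k) \<le> 8" by simp
  have "\<eta> h \<ominus>\<^bsub>B\<^esub> \<eta> g = c \<odot>\<^bsub>B\<^esub> \<eta> ?k"
  proof -
    have "h \<ominus>\<^bsub>A\<^esub> g = c \<odot>\<^bsub>A\<^esub> ?k"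
      unfolding g_def using Suc.prems(1) k(1)
      by (simp add: A.diff_smult A.smult_add_right A.a_assoc[symmetric] A.r_neg flip: A.minus_smult)
    then show ?thesis using Suc.prems(1) k(1) g(1) by (metis hom_diff hom_smult)
  qed
  then have "cnorm B (\<eta> h \<ominus>\<^bsub>B\<^esub> \<eta> g) = q / 12 * cnorm B (\<eta> ?k)"
    using k(1) by (simp only: B.cnorm_smult hom_closed cmc)
  also have "\<dots> \<le> q / 12 * 8" using q k8 by (intro mult_left_mono) simp_all
  finally have dev: "cnorm B (\<eta> g \<ominus>\<^bsub>B\<^esub> \<eta> h) \<le> q"
    using B.cnorm_diff_comm[of "\<eta> h" "\<eta> g"] Suc.prems(1) g(1) q by simp
  have "cnorm B (\<eta> g) \<le> 3/2 + (1/3) * (1/4) ^ m"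
    using B.cnorm_le_diff[of "\<eta> g" "\<eta> h"] dev Suc.prems(1,4) g(1) unfolding qm q_def[symmetric] by simp
  then obtain a where a: "a \<in> carrier A" "adj A a = a" "cnorm A a < 4"
      "cnorm B (\<eta> a \<ominus>\<^bsub>B\<^esub> \<eta> g) \<le> (1/3) * (1 - (1/4) ^ m)"
    using Suc.IH[OF g gn] by blast
  have "cnorm B (\<eta> a \<ominus>\<^bsub>B\<^esub> \<eta> h) \<le> (1/3) * (1 - q)"
    using B.cnorm_diff_triangle[of "\<eta> a" "\<eta> g" "\<eta> h"] a(1,4) dev Suc.prems(1) g(1) unfolding qm by simp
  with a show ?case unfolding q_def by blast
qed

section \<open>The closure of the range and exact lifts of its elements\<close>

definition adherent :: "'b \<Rightarrow> bool" where
  "adherent b \<longleftrightarrow> b \<in> carrier B \<and> (\<forall>\<epsilon>>0. \<exists>a\<in>carrier A. cnorm B (\<eta> a \<ominus>\<^bsub>B\<^esub> b) < \<epsilon>)"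

lemma adherent_lin:
  assumes "adherent b" "a \<in> carrier A"
  shows "adherent (c \<odot>\<^bsub>B\<^esub> (b \<ominus>\<^bsub>B\<^esub> \<eta> a))"
  unfolding adherent_def
proof (intro conjI allI impI)
  have b: "b \<in> carrier B" using assms by (simp add: adherent_def)
  then show "c \<odot>\<^bsub>B\<^esub> (b \<ominus>\<^bsub>B\<^esub> \<eta> a) \<in> carrier B" using assms by simp
  fix \<epsilon> :: real assume "\<epsilon> > 0"
  \<comment> \<open>The added 1 admits c = 0.\<close>
  then have "\<epsilon> / (cmod c + 1) > 0" by (simp add: add_nonneg_pos)
  then obtain x where x: "x \<in> carrier A" "cnorm B (\<eta> x \<ominus>\<^bsub>B\<^esub> b) < \<epsilon> / (cmod c + 1)"
    using assms(1) unfolding adherent_def by blast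
  have "\<eta> (c \<odot>\<^bsub>A\<^esub> (x \<ominus>\<^bsub>A\<^esub> a)) \<ominus>\<^bsub>B\<^esub> c \<odot>\<^bsub>B\<^esub> (b \<ominus>\<^bsub>B\<^esub> \<eta> a) = c \<odot>\<^bsub>B\<^esub> (\<eta> x \<ominus>\<^bsub>B\<^esub> b)"
    using x(1) assms(2) b
    by (simp add: hom_smult hom_diff B.smult_diff[symmetric] B.diff_diff_diff)
  then have "cnorm B (\<eta> (c \<odot>\<^bsub>A\<^esub> (x \<ominus>\<^bsub>A\<^esub> a)) \<ominus>\<^bsub>B\<^esub> c \<odot>\<^bsub>B\<^esub> (b \<ominus>\<^bsub>B\<^esub> \<eta> a))
    \<le> (cmod c + 1) * cnorm B (\<eta> x \<ominus>\<^bsub>B\<^esub> b)"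
    using x(1) b by (simp add: B.cnorm_smult mult_right_mono)
  also have "\<dots> < (cmod c + 1) * (\<epsilon> / (cmod c + 1))"
    using x(2) by (intro mult_strict_left_mono) (simp_all add: add_nonneg_pos)
  also have "\<dots> = \<epsilon>" by (simp add: add_nonneg_eq_0_iff)
  finally show "\<exists>a'\<in>carrier A. cnorm B (\<eta> a' \<ominus>\<^bsub>B\<^esub> c \<odot>\<^bsub>B\<^esub> (b \<ominus>\<^bsub>B\<^esub> \<eta> a)) < \<epsilon>"
    using x(1) assms(2) by (intro bexI[of _ "c \<odot>\<^bsub>A\<^esub> (x \<ominus>\<^bsub>A\<^esub> a)"]) simp_all
qed

lemma adherent_add_adj:
  assumes "adherent b"
  shows "adherent (b \<oplus>\<^bsub>B\<^esub> adj B b)"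
  unfolding adherent_def
proof (intro conjI allI impI)
  have b: "b \<in> carrier B" using assms by (simp add: adherent_def)
  then show "b \<oplus>\<^bsub>B\<^esub> adj B b \<in> carrier B" by simp
  fix \<epsilon> :: real assume "\<epsilon> > 0"
  then have "\<epsilon> / 2 > 0" by simp
  then obtain x where x: "x \<in> carrier A" "cnorm B (\<eta> x \<ominus>\<^bsub>B\<^esub> b) < \<epsilon> / 2"
    using assms unfolding adherent_def by blast
  have eq: "\<eta> (x \<oplus>\<^bsub>A\<^esub> adj A x) \<ominus>\<^bsub>B\<^esub> (b \<oplus>\<^bsub>B\<^esub> adj B b)
    = (\<eta> x \<ominus>\<^bsub>B\<^esub> b) \<oplus>\<^bsub>B\<^esub> adj B (\<eta> x \<ominus>\<^bsub>B\<^esub> b)"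
    using x(1) b by (simp add: hom_add hom_adj B.add_diff_add B.adj_diff)
  have "cnorm B (\<eta> (x \<oplus>\<^bsub>A\<^esub> adj A x) \<ominus>\<^bsub>B\<^esub> (b \<oplus>\<^bsub>B\<^esub> adj B b)) < \<epsilon>"
    unfolding eq using x b B.cnorm_triangle[of "\<eta> x \<ominus>\<^bsub>B\<^esub> b" "adj B (\<eta> x \<ominus>\<^bsub>B\<^esub> b)"] by simp
  then show "\<exists>a\<in>carrier A. cnorm B (\<eta> a \<ominus>\<^bsub>B\<^esub> (b \<oplus>\<^bsub>B\<^esub> adj B b)) < \<epsilon>"
    using x(1) by (intro bexI[of _ "x \<oplus>\<^bsub>A\<^esub> adj A x"]) simp_all
qed

lemma adherent_approximate_lift:
  assumes b: "adherent b" "adj B b = b" "cnorm B b \<le> r" and r: "r > 0"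
  shows "\<exists>a\<in>carrier A. adj A a = a \<and> cnorm A a \<le> 4 * r \<and> cnorm B (b \<ominus>\<^bsub>B\<^esub> \<eta> a) \<le> r / 2"
proof -
  have bB: "b \<in> carrier B" using b by (simp add: adherent_def)
  have "r / 6 > 0" using r by simp
  then obtain x where x: "x \<in> carrier A" "cnorm B (\<eta> x \<ominus>\<^bsub>B\<^esub> b) < r / 6"
    using b(1) unfolding adherent_def by blast
  \<comment> \<open>The self-adjoint part of x approximates at least as well as x, because b is
    self-adjoint.\<close>
  define h where "h = (1/2) \<odot>\<^bsub>A\<^esub> (x \<oplus>\<^bsub>A\<^esub> adj A x)"
  have h: "h \<in> carrier A" "adj A h = h"
    using x(1) by (simp_all add: h_def A.adj_smult A.adj_add A.a_comm)
  have "\<eta> h \<ominus>\<^bsub>B\<^esub> b = (1/2) \<odot>\<^bsub>B\<^esub> ((\<eta> x \<ominus>\<^bsub>B\<^esub> b) \<oplus>\<^bsub>B\<^esub> adj B (\<eta> x \<ominus>\<^bsub>B\<^esub> b))"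
  proof -
    have "b = (1/2) \<odot>\<^bsub>B\<^esub> (b \<oplus>\<^bsub>B\<^esub> b)"
      using bB B.smult_add_left[of b "1/2" "1/2"] by (simp add: B.smult_add_right)
    then have "\<eta> h \<ominus>\<^bsub>B\<^esub> b = \<eta> h \<ominus>\<^bsub>B\<^esub> (1/2) \<odot>\<^bsub>B\<^esub> (b \<oplus>\<^bsub>B\<^esub> b)" by (rule arg_cong)
    also have "\<dots> = (1/2) \<odot>\<^bsub>B\<^esub> ((\<eta> x \<ominus>\<^bsub>B\<^esub> b) \<oplus>\<^bsub>B\<^esub> adj B (\<eta> x \<ominus>\<^bsub>B\<^esub> b))"
      using x(1) bB b(2)
      by (simp add: h_def hom_smult hom_add hom_adj B.smult_diff[symmetric] B.add_diff_add B.adj_diff)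
    finally show ?thesis .
  qed
  then have hb: "cnorm B (\<eta> h \<ominus>\<^bsub>B\<^esub> b) \<le> r / 6"
    using x bB B.cnorm_triangle[of "\<eta> x \<ominus>\<^bsub>B\<^esub> b" "adj B (\<eta> x \<ominus>\<^bsub>B\<^esub> b)"]
    by (simp add: B.cnorm_smult)
  define g where "g = complex_of_real (1 / r) \<odot>\<^bsub>A\<^esub> h"
  have g: "g \<in> carrier A" "adj A g = g" using h by (simp_all add: g_def A.adj_smult)
  have hg: "h = complex_of_real r \<odot>\<^bsub>A\<^esub> g" using h r by (simp add: g_def)
  \<comment> \<open>The number of reductions that bring g down to norm below 4.\<close>
  obtain m where m: "cnorm A g < 4 * 2 ^ m"
  proof -
    obtain m where "cnorm A g < 2 ^ m" using real_arch_pow[of 2 "cnorm A g"] by auto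
    moreover have "(2::real) ^ m \<le> 4 * 2 ^ m" by simp
    ultimately show thesis using that by (meson less_le_trans)
  qed
  have "cnorm B (\<eta> h) \<le> r + r / 6"
    using B.cnorm_le_diff[of "\<eta> h" b] h(1) bB hb b(3) by simp
  then have "cnorm B (\<eta> g) \<le> 3/2"
    using h(1) r by (simp add: g_def hom_smult B.cnorm_smult norm_divide field_simps)
  then have "cnorm B (\<eta> g) \<le> 3/2 + (1/3) * (1/4) ^ m"
    by (rule order_trans) simp
  from bounded_approximate_lift[OF g m this]
  obtain a where a: "a \<in> carrier A" "adj A a = a" "cnorm A a < 4"
    "cnorm B (\<eta> a \<ominus>\<^bsub>B\<^esub> \<eta> g) \<le> (1/3) * (1 - (1/4) ^ m)"
    by blast
  define y where "y = complex_of_real r \<odot>\<^bsub>A\<^esub> a"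
  have y: "y \<in> carrier A" "adj A y = y" "cnorm A y \<le> 4 * r"
    using a r by (simp_all add: y_def A.adj_smult A.cnorm_smult)
  have "\<eta> y \<ominus>\<^bsub>B\<^esub> \<eta> h = complex_of_real r \<odot>\<^bsub>B\<^esub> (\<eta> a \<ominus>\<^bsub>B\<^esub> \<eta> g)"
    unfolding y_def hg using a(1) g(1) by (simp add: hom_smult B.smult_diff)
  then have "cnorm B (\<eta> y \<ominus>\<^bsub>B\<^esub> \<eta> h) = r * cnorm B (\<eta> a \<ominus>\<^bsub>B\<^esub> \<eta> g)"
    using a(1) g(1) r by (simp add: B.cnorm_smult)
  also have "\<dots> \<le> r * (1/3)"
  proof (rule mult_left_mono)
    have "(0::real) \<le> (1/4) ^ m" by simp
    then show "cnorm B (\<eta> a \<ominus>\<^bsub>B\<^esub> \<eta> g) \<le> 1/3" using a(4) by argo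
  qed (use r in simp)
  finally have "cnorm B (b \<ominus>\<^bsub>B\<^esub> \<eta> y) \<le> r / 2"
    using B.cnorm_diff_triangle[of "\<eta> y" "\<eta> h" b] hb y(1) h(1) bB
    by (simp add: B.cnorm_diff_comm[of b])
  with y show ?thesis by blast
qed

text \<open>Each correction has norm at most four times the current error bound and halves that
  bound. The corrections therefore form a convergent series in the domain, whose sum is mapped to b
  by continuity.\<close>

lemma adherent_selfadjoint_lift:
  assumes b: "adherent b" "adj B b = b"
  shows "b \<in> \<eta> ` carrier A"
proof -
  have bB: "b \<in> carrier B" using b by (simp add: adherent_def)
  \<comment> \<open>The added 1 keeps the error bound positive even for b = 0.\<close>
  define K where "K = cnorm B b + 1"
  have K: "K > 0" using B.cnorm_nonneg[OF bB] by (simp add: K_def)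
  define P where "P n s \<longleftrightarrow> s \<in> carrier A \<and> adj A s = s \<and> cnorm B (b \<ominus>\<^bsub>B\<^esub> \<eta> s) \<le> K * (1/2) ^ n"
    for n :: nat and s
  define Q where "Q n s s' \<longleftrightarrow> cnorm A (s' \<ominus>\<^bsub>A\<^esub> s) \<le> (4 * K) * (1/2) ^ n" for n :: nat and s s'
  have "\<exists>f. \<forall>n. P n (f n) \<and> Q n (f n) (f (Suc n))"
  proof (rule dependent_nat_choice)
    show "\<exists>s. P 0 s" unfolding P_def using bB by (intro exI[of _ "\<zero>\<^bsub>A\<^esub>"]) (simp add: K_def)
    fix s n assume "P n s"
    then have s: "s \<in> carrier A" "adj A s = s" "cnorm B (b \<ominus>\<^bsub>B\<^esub> \<eta> s) \<le> K * (1/2) ^ n"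
      by (auto simp: P_def)
    have "adherent (b \<ominus>\<^bsub>B\<^esub> \<eta> s)" using adherent_lin[OF b(1) s(1), of 1] bB s(1) by simp
    moreover have "adj B (b \<ominus>\<^bsub>B\<^esub> \<eta> s) = b \<ominus>\<^bsub>B\<^esub> \<eta> s"
      using bB b(2) s by (simp add: B.adj_diff hom_adj[symmetric])
    moreover have "0 < K * (1/2) ^ n" using K by simp
    ultimately obtain a where a: "a \<in> carrier A" "adj A a = a" "cnorm A a \<le> 4 * (K * (1/2) ^ n)"
      "cnorm B (b \<ominus>\<^bsub>B\<^esub> \<eta> s \<ominus>\<^bsub>B\<^esub> \<eta> a) \<le> K * (1/2) ^ n / 2"
      using adherent_approximate_lift[of "b \<ominus>\<^bsub>B\<^esub> \<eta> s"] s(3) by blast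
    have "b \<ominus>\<^bsub>B\<^esub> \<eta> (s \<oplus>\<^bsub>A\<^esub> a) = b \<ominus>\<^bsub>B\<^esub> \<eta> s \<ominus>\<^bsub>B\<^esub> \<eta> a"
      using bB s(1) a(1) by (simp add: hom_add B.diff_smult B.smult_add_right B.a_assoc)
    then have "P (Suc n) (s \<oplus>\<^bsub>A\<^esub> a)"
      using a s by (simp add: P_def A.adj_add)
    moreover have "s \<oplus>\<^bsub>A\<^esub> a \<ominus>\<^bsub>A\<^esub> s = a"
      using s(1) a(1) by (simp add: A.minus_eq A.a_assoc A.a_comm[of a] A.r_neg2)
    then have "Q n s (s \<oplus>\<^bsub>A\<^esub> a)" using a(3) by (simp add: Q_def)
    ultimately show "\<exists>s'. P (Suc n) s' \<and> Q n s s'" by blast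
  qed
  then obtain f where f: "\<And>n. P n (f n)" "\<And>n. Q n (f n) (f (Suc n))" by blast
  have fc: "f n \<in> carrier A" for n using f(1)[of n] by (simp add: P_def)
  obtain l where l: "l \<in> carrier A" "A.lim_to f l"
    using A.lim_to_geometric[OF fc _ _ f(2)[unfolded Q_def]] by auto
  have "B.lim_to (\<lambda>n. \<eta> (f n)) b"
  proof (rule B.lim_to_bound)
    show "(\<lambda>n. K * (1/2) ^ n) \<longlonglongrightarrow> 0" by (intro tendsto_mult_right_zero LIMSEQ_realpow_zero) simp_all
    show "cnorm B (\<eta> (f n) \<ominus>\<^bsub>B\<^esub> b) \<le> K * (1/2) ^ n" for n
      using f(1)[of n] bB B.cnorm_diff_comm[of "\<eta> (f n)" b] by (simp add: P_def)
  qed (use fc bB in auto)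
  with hom_lim[OF fc l] have "\<eta> l = b"
    using B.lim_to_unique[of "\<lambda>n. \<eta> (f n)" "\<eta> l" b] fc l(1) bB by simp
  with l(1) show ?thesis by blast
qed

lemma range_closed:
  assumes f: "\<And>n. f n \<in> \<eta> ` carrier A" and b: "b \<in> carrier B" and lim: "B.lim_to f b"
  shows "b \<in> \<eta> ` carrier A"
proof -
  have ad: "adherent b"
    unfolding adherent_def
  proof (intro conjI allI impI b)
    fix \<epsilon> :: real assume "\<epsilon> > 0"
    from order_tendstoD(2)[OF lim[unfolded B.lim_to_def] this]
    obtain n where "cnorm B (f n \<ominus>\<^bsub>B\<^esub> b) < \<epsilon>" unfolding eventually_sequentially by blast
    with f[of n] show "\<exists>a\<in>carrier A. cnorm B (\<eta> a \<ominus>\<^bsub>B\<^esub> b) < \<epsilon>" by auto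
  qed
  \<comment> \<open>Multiplying \<open>b2 + adj b2\<close> by i gives \<open>b - adj b\<close>;
    adding \<open>b + adj b\<close> yields 2b. Lifts of these two self-adjoint elements therefore
    suffice.\<close>
  define b2 where "b2 = (- \<i>) \<odot>\<^bsub>B\<^esub> b"
  have b2: "adherent b2" "b2 \<in> carrier B"
    using adherent_lin[OF ad, of "\<zero>\<^bsub>A\<^esub>" "- \<i>"] b by (simp_all add: b2_def)
  have "b \<oplus>\<^bsub>B\<^esub> adj B b \<in> \<eta> ` carrier A"
    using ad b by (intro adherent_selfadjoint_lift adherent_add_adj) (simp_all add: B.adj_add B.a_comm)
  then obtain x where x: "x \<in> carrier A" "\<eta> x = b \<oplus>\<^bsub>B\<^esub> adj B b" by auto
  have "b2 \<oplus>\<^bsub>B\<^esub> adj B b2 \<in> \<eta> ` carrier A"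
    using b2 by (intro adherent_selfadjoint_lift adherent_add_adj) (simp_all add: B.adj_add B.a_comm)
  then obtain y where y: "y \<in> carrier A" "\<eta> y = b2 \<oplus>\<^bsub>B\<^esub> adj B b2" by auto
  have "\<eta> ((1/2) \<odot>\<^bsub>A\<^esub> (x \<oplus>\<^bsub>A\<^esub> \<i> \<odot>\<^bsub>A\<^esub> y)) = (1/2) \<odot>\<^bsub>B\<^esub> (b \<oplus>\<^bsub>B\<^esub> adj B b \<oplus>\<^bsub>B\<^esub> (b \<oplus>\<^bsub>B\<^esub> (- 1) \<odot>\<^bsub>B\<^esub> adj B b))"
    using x y b by (simp add: hom_add hom_smult b2_def B.adj_smult B.smult_add_right)
  also have "b \<oplus>\<^bsub>B\<^esub> adj B b \<oplus>\<^bsub>B\<^esub> (b \<oplus>\<^bsub>B\<^esub> (- 1) \<odot>\<^bsub>B\<^esub> adj B b) = b \<oplus>\<^bsub>B\<^esub> b"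
    using b by (simp add: B.a_ac B.r_neg2 B.r_neg flip: B.minus_smult)
  also have "(1/2) \<odot>\<^bsub>B\<^esub> (b \<oplus>\<^bsub>B\<^esub> b) = b"
    using b B.smult_add_left[of b "1/2" "1/2"] by (simp add: B.smult_add_right)
  finally show ?thesis using x(1) y(1)
    by (intro image_eqI[of _ _ "(1/2) \<odot>\<^bsub>A\<^esub> (x \<oplus>\<^bsub>A\<^esub> \<i> \<odot>\<^bsub>A\<^esub> y)"]) simp_all
qed

end

section \<open>The quotient by a central projection\<close>

text \<open>In the application z is the image of the empty map, or zero when that map is absent, so
  both cases of the quotient share one construction.\<close>

locale central_projection = unital_cstar_algebra A for A :: "'a cstar" (structure) +
  fixes z :: 'a
  assumes z_closed [simp]: "z \<in> carrier A"
    and z_adj: "adj A z = z"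
    and z_idem: "z \<otimes> z = z"
    and z_central: "x \<in> carrier A \<Longrightarrow> z \<otimes> x = x \<otimes> z"
begin

definition N :: "'a set" where "N = {x \<otimes> z | x. x \<in> carrier A}"

text \<open>Compression to the complement of z. Each coset of \<open>N\<close> contains exactly one
  element fixed by \<open>cut\<close>, and this element has least norm in the coset.\<close>

definition cut :: "'a \<Rightarrow> 'a" where "cut x = x \<otimes> (\<one> \<ominus> z)"

definition cls :: "'a \<Rightarrow> 'a set" where "cls x = N +>\<^bsub>A\<^esub> x"

abbreviation "Q \<equiv> cstar_quot A N"

lemma cut_eq: "x \<in> carrier A \<Longrightarrow> cut x = x \<ominus> x \<otimes> z"
  by (simp add: cut_def mult_diff)

lemma cut_closed [simp]: "x \<in> carrier A \<Longrightarrow> cut x \<in> carrier A"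
  by (simp add: cut_def)

lemma cut_add: "\<lbrakk>x \<in> carrier A; y \<in> carrier A\<rbrakk> \<Longrightarrow> cut (x \<oplus> y) = cut x \<oplus> cut y"
  by (simp add: cut_def mult_l_distr)

lemma cut_smult: "x \<in> carrier A \<Longrightarrow> cut (k \<odot>\<^bsub>A\<^esub> x) = k \<odot>\<^bsub>A\<^esub> cut x"
  by (simp add: cut_def smult_mult_l)

lemma cut_diff: "\<lbrakk>x \<in> carrier A; y \<in> carrier A\<rbrakk> \<Longrightarrow> cut (x \<ominus> y) = cut x \<ominus> cut y"
  by (simp add: cut_def diff_mult)

lemma cut_z [simp]: "cut z = \<zero>"
  by (simp add: cut_eq z_idem)

lemma cut_mult_z [simp]: "x \<in> carrier A \<Longrightarrow> cut (x \<otimes> z) = \<zero>"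
  using cut_z by (simp add: cut_def mult_assoc)

lemma cut_idem [simp]: "x \<in> carrier A \<Longrightarrow> cut (cut x) = cut x"
  by (simp add: cut_eq[of x] cut_diff)

lemma cut_adj: "x \<in> carrier A \<Longrightarrow> cut (adj A x) = adj A (cut x)"
  by (simp add: cut_eq adj_diff adj_mult z_adj z_central)

text \<open>The central idempotent 1 - z can be duplicated and moved across a factor.\<close>

lemma cut_mult: "\<lbrakk>x \<in> carrier A; y \<in> carrier A\<rbrakk> \<Longrightarrow> cut (x \<otimes> y) = cut x \<otimes> cut y"
proof -
  assume x: "x \<in> carrier A" "y \<in> carrier A"
  have 1: "(\<one> \<ominus> z) \<otimes> y = y \<otimes> (\<one> \<ominus> z)" using x by (simp add: diff_mult mult_diff z_central)
  have 2: "(\<one> \<ominus> z) \<otimes> (\<one> \<ominus> z) = \<one> \<ominus> z" by (simp add: diff_mult mult_diff z_idem)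
  have "cut x \<otimes> cut y = x \<otimes> ((\<one> \<ominus> z) \<otimes> y) \<otimes> (\<one> \<ominus> z)"
    using x by (simp add: cut_def mult_assoc)
  also have "\<dots> = cut (x \<otimes> y)" unfolding 1 using x by (simp add: cut_def mult_assoc 2)
  finally show ?thesis by simp
qed

text \<open>1 - z is a projection, so its norm is 0 or 1.\<close>

lemma cnorm_cut_le: "x \<in> carrier A \<Longrightarrow> cnorm A (cut x) \<le> cnorm A x"
proof -
  assume x: "x \<in> carrier A"
  have "(cnorm A (\<one> \<ominus> z))\<^sup>2 = cnorm A (\<one> \<ominus> z)"
    using cstar_identity[of "\<one> \<ominus> z"] by (simp add: adj_diff z_adj diff_mult mult_diff z_idem)
  then have "cnorm A (\<one> \<ominus> z) \<le> 1"
    by (metis order_refl power2_eq_square mult_cancel_right1 zero_le_one)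
  then have "cnorm A x * cnorm A (\<one> \<ominus> z) \<le> cnorm A x * 1"
    using x by (intro mult_left_mono) simp_all
  then show ?thesis using cnorm_mult[of x "\<one> \<ominus> z"] x by (simp add: cut_def)
qed

lemma ideal_N: "ideal N A"
proof (rule idealI)
  show "ring A"
  proof (rule ringI)
    show "abelian_group A" by unfold_locales
    show "monoid A" by (rule monoidI) (simp_all add: mult_assoc)
  qed (simp_all add: mult_l_distr mult_r_distr)
  show "subgroup N (add_monoid A)"
  proof (rule subgroup.intro)
    show "N \<subseteq> carrier (add_monoid A)" by (auto simp: N_def)
    show "\<one>\<^bsub>add_monoid A\<^esub> \<in> N" unfolding N_def by (auto intro!: exI[of _ \<zero>])
    fix x y assume "x \<in> N" "y \<in> N"
    then obtain a b where "a \<in> carrier A" "b \<in> carrier A" "x = a \<otimes> z" "y = b \<otimes> z"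
      by (auto simp: N_def)
    then show "x \<otimes>\<^bsub>add_monoid A\<^esub> y \<in> N"
      unfolding N_def by (auto intro!: exI[of _ "a \<oplus> b"] simp: mult_l_distr)
  next
    fix x assume "x \<in> N"
    then obtain a where "a \<in> carrier A" "x = a \<otimes> z" by (auto simp: N_def)
    then show "inv\<^bsub>add_monoid A\<^esub> x \<in> N"
      unfolding N_def a_inv_def[symmetric] by (auto intro!: exI[of _ "\<ominus> a"] simp: minus_smult smult_mult_l)
  qed
next
  fix a x assume "a \<in> N" and x: "x \<in> carrier A"
  then obtain b where b: "b \<in> carrier A" "a = b \<otimes> z" by (auto simp: N_def)
  show "x \<otimes> a \<in> N" unfolding N_def using b x by (auto intro!: exI[of _ "x \<otimes> b"] simp: mult_assoc)
  show "a \<otimes> x \<in> N" unfolding N_def using b x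
    by (auto intro!: exI[of _ "b \<otimes> x"] simp: mult_assoc z_central)
qed

interpretation ideal N A by (rule ideal_N)

text \<open>Every y is the sum of \<open>cut y\<close> and an element of \<open>N\<close>, so the
  coset of y depends on \<open>cut y\<close> alone. Equations between cosets thereby become
  equations in the algebra.\<close>

lemma cls_eq: "x \<in> carrier A \<Longrightarrow> cls x = {y \<in> carrier A. cut y = cut x}"
proof (intro equalityI subsetI)
  fix y assume x: "x \<in> carrier A"
  { assume "y \<in> cls x"
    then obtain w where "w \<in> carrier A" "y = w \<otimes> z \<oplus> x"
      unfolding cls_def N_def a_r_coset_def' by blast
    then show "y \<in> {y \<in> carrier A. cut y = cut x}" using x by (simp add: cut_add) }
  { assume "y \<in> {y \<in> carrier A. cut y = cut x}"
    then have y: "y \<in> carrier A" "cut y = cut x" by auto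
    have "y = cut y \<oplus> y \<otimes> z" using y(1) by (simp add: cut_eq)
    also have "\<dots> = (y \<ominus> x) \<otimes> z \<oplus> x"
      unfolding y(2) using x y(1) by (simp add: cut_eq diff_mult) (simp add: minus_eq a_ac)
    finally show "y \<in> cls x"
      unfolding cls_def N_def a_r_coset_def' using x y(1) by blast }
qed

lemma cls_eq_iff: "\<lbrakk>x \<in> carrier A; y \<in> carrier A\<rbrakk> \<Longrightarrow> cls x = cls y \<longleftrightarrow> cut x = cut y"
  by (auto simp: cls_eq)

lemma carrier_quot: "carrier Q = cls ` carrier A"
  by (auto simp: cstar_quot_def FactRing_def A_RCOSETS_def' cls_def)

lemma cls_closed [simp]: "x \<in> carrier A \<Longrightarrow> cls x \<in> carrier Q"
  by (simp add: carrier_quot)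

lemma cls_cut: "x \<in> carrier A \<Longrightarrow> cls (cut x) = cls x"
  by (simp add: cls_eq_iff)

lemma cls_add [simp]: "\<lbrakk>x \<in> carrier A; y \<in> carrier A\<rbrakk> \<Longrightarrow> cls x \<oplus>\<^bsub>Q\<^esub> cls y = cls (x \<oplus> y)"
  by (simp add: cstar_quot_def FactRing_def cls_def a_rcos_sum)

lemma cls_mult [simp]: "\<lbrakk>x \<in> carrier A; y \<in> carrier A\<rbrakk> \<Longrightarrow> cls x \<otimes>\<^bsub>Q\<^esub> cls y = cls (x \<otimes> y)"
  by (simp add: cstar_quot_def FactRing_def cls_def rcoset_mult_add)

lemma one_quot: "\<one>\<^bsub>Q\<^esub> = cls \<one>"
  by (simp add: cstar_quot_def FactRing_def cls_def)

lemma zero_quot: "\<zero>\<^bsub>Q\<^esub> = cls \<zero>"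
  unfolding cls_def a_coset_add_zero[OF a_subset] by (simp add: cstar_quot_def FactRing_def)

lemma cls_smult [simp]: assumes x: "x \<in> carrier A" shows "k \<odot>\<^bsub>Q\<^esub> cls x = cls (k \<odot>\<^bsub>A\<^esub> x)"
proof -
  \<comment> \<open>The scalar multiple is a union over the coset: all members contribute the same
    class, and the coset is nonempty.\<close>
  have "cls (k \<odot>\<^bsub>A\<^esub> y) = cls (k \<odot>\<^bsub>A\<^esub> x)" if "y \<in> cls x" for y
    using that x by (simp add: cls_eq cut_smult)
  moreover have "x \<in> cls x" using x by (simp add: cls_eq)
  moreover have "k \<odot>\<^bsub>Q\<^esub> cls x = (\<Union>y\<in>cls x. cls (k \<odot>\<^bsub>A\<^esub> y))"
    by (simp add: cstar_quot_def cls_def)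
  ultimately show ?thesis by blast
qed

lemma cls_adj [simp]: assumes x: "x \<in> carrier A" shows "adj Q (cls x) = cls (adj A x)"
proof -
  have "adj A y \<in> cls (adj A x)" if "y \<in> cls x" for y
    using that x by (simp add: cls_eq cut_adj)
  moreover have "y \<in> adj A ` cls x" if "y \<in> cls (adj A x)" for y
    using that x by (intro image_eqI[of _ _ "adj A y"]) (simp_all add: cls_eq cut_adj)
  ultimately have "adj A ` cls x = cls (adj A x)" by blast
  then show ?thesis by (simp add: cstar_quot_def)
qed

text \<open>\<open>cut\<close> is contractive and constant on a coset, and its value belongs to the
  coset, so the infimum is attained there.\<close>

lemma cnorm_cls: assumes x: "x \<in> carrier A" shows "cnorm Q (cls x) = cnorm A (cut x)"
proof -
  have "cnorm Q (cls x) = (INF y\<in>cls x. cnorm A y)" by (simp add: cstar_quot_def)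
  also have "\<dots> = cnorm A (cut x)"
  proof (rule cInf_eq_minimum)
    show "cnorm A (cut x) \<in> cnorm A ` cls x" using x by (simp add: cls_eq)
    show "cnorm A (cut x) \<le> r" if "r \<in> cnorm A ` cls x" for r
      using that x cnorm_cut_le by (force simp: cls_eq)
  qed
  finally show ?thesis .
qed

lemma abelian_group_quot: "abelian_group Q"
proof (rule abelian_groupI)
  fix X assume "X \<in> carrier Q"
  then obtain x where "x \<in> carrier A" "X = cls x" by (auto simp: carrier_quot)
  then show "\<exists>Y\<in>carrier Q. Y \<oplus>\<^bsub>Q\<^esub> X = \<zero>\<^bsub>Q\<^esub>"
    by (intro bexI[of _ "cls (\<ominus> x)"]) (simp_all add: zero_quot l_neg)
qed (auto simp: carrier_quot zero_quot a_ac)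

lemma cls_diff [simp]:
  assumes "x \<in> carrier A" "y \<in> carrier A" shows "cls x \<ominus>\<^bsub>Q\<^esub> cls y = cls (x \<ominus> y)"
proof -
  interpret q: abelian_group Q by (rule abelian_group_quot)
  have "\<ominus>\<^bsub>Q\<^esub> cls y = cls (\<ominus> y)"
    using assms by (intro q.minus_equality) (simp_all add: zero_quot l_neg)
  then show ?thesis using assms by (simp add: a_minus_def)
qed

text \<open>Representatives fixed by \<open>cut\<close> turn the quotient norm into the norm of the
  algebra, so Cauchy sequences lift. For the limit, contractivity of the class map is
  enough.\<close>

lemma quot_complete:
  assumes f: "range f \<subseteq> carrier Q"
    and "\<And>\<epsilon>. \<epsilon> > 0 \<Longrightarrow> \<exists>M. \<forall>m\<ge>M. \<forall>n\<ge>M. cnorm Q (f m \<ominus>\<^bsub>Q\<^esub> f n) < \<epsilon>"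
  shows "\<exists>L\<in>carrier Q. (\<lambda>n::nat. cnorm Q (f n \<ominus>\<^bsub>Q\<^esub> L)) \<longlonglongrightarrow> 0"
proof -
  have "\<exists>x\<in>carrier A. cut x = x \<and> f n = cls x" for n
  proof -
    have "f n \<in> carrier Q" using f by auto
    then obtain y where "y \<in> carrier A" "f n = cls y" by (auto simp: carrier_quot)
    then show ?thesis by (intro bexI[of _ "cut y"]) (simp_all add: cls_cut)
  qed
  then obtain g where g [simp]: "\<And>n. g n \<in> carrier A" "\<And>n. cut (g n) = g n" and fg: "\<And>n. f n = cls (g n)"
    by metis
  have "\<exists>l\<in>carrier A. (\<lambda>n. cnorm A (g n \<ominus> l)) \<longlonglongrightarrow> 0"
  proof (rule complete)
    show "range g \<subseteq> carrier A" by auto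
    fix \<epsilon> :: real assume "\<epsilon> > 0"
    from assms(2)[OF this] show "\<exists>M. \<forall>m\<ge>M. \<forall>n\<ge>M. cnorm A (g m \<ominus> g n) < \<epsilon>"
      by (simp add: fg cnorm_cls cut_diff)
  qed
  then obtain l where l: "l \<in> carrier A" "(\<lambda>n. cnorm A (g n \<ominus> l)) \<longlonglongrightarrow> 0" by blast
  have "(\<lambda>n. cnorm Q (f n \<ominus>\<^bsub>Q\<^esub> cls l)) \<longlonglongrightarrow> 0"
  proof (rule tendsto_sandwich[OF _ _ tendsto_const l(2)])
    show "\<forall>\<^sub>F n in sequentially. 0 \<le> cnorm Q (f n \<ominus>\<^bsub>Q\<^esub> cls l)"
      using l(1) by (simp add: fg cnorm_cls)
    show "\<forall>\<^sub>F n in sequentially. cnorm Q (f n \<ominus>\<^bsub>Q\<^esub> cls l) \<le> cnorm A (g n \<ominus> l)"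
      using l(1) by (simp add: fg cnorm_cls cnorm_cut_le)
  qed
  then show ?thesis using l(1) by (intro bexI[of _ "cls l"]) simp_all
qed

lemma cnorm_cls_le: "x \<in> carrier A \<Longrightarrow> cnorm Q (cls x) \<le> cnorm A x"
  by (simp add: cnorm_cls cnorm_cut_le)

lemma quot_unital_cstar: "unital_cstar_algebra Q"
proof (intro unital_cstar_algebra.intro cstar_algebra.intro)
  show "module complex_ring Q"
    by (rule module.intro[OF complex_ring_cring abelian_group_quot], unfold_locales)
      (auto simp: carrier_quot smult_add_left smult_add_right)
  show "cstar_algebra_axioms Q"
  proof (rule cstar_algebra_axioms.intro)
    fix X assume "X \<in> carrier Q"
    then obtain x where x: "x \<in> carrier A" "X = cls x" by (auto simp: carrier_quot)
    \<comment> \<open>The quotient norm is the norm of \<open>cut\<close>, which respects products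
      and adjoints; the identity is inherited from \<open>cut x\<close>.\<close>
    show "cnorm Q (adj Q X \<otimes>\<^bsub>Q\<^esub> X) = (cnorm Q X)\<^sup>2"
      using x cstar_identity[of "cut x"] by (simp add: cnorm_cls cut_mult cut_adj)
    show "cnorm Q X = 0 \<longleftrightarrow> X = \<zero>\<^bsub>Q\<^esub>"
      using x by (simp add: cnorm_cls zero_quot cls_eq_iff cnorm_eq_zero) (simp add: cut_eq)
  next
    fix f :: "nat \<Rightarrow> 'a set"
    assume "range f \<subseteq> carrier Q"
      and "\<And>\<epsilon>. \<epsilon> > 0 \<Longrightarrow> \<exists>M. \<forall>m\<ge>M. \<forall>n\<ge>M. cnorm Q (f m \<ominus>\<^bsub>Q\<^esub> f n) < \<epsilon>"
    then show "\<exists>L\<in>carrier Q. (\<lambda>n. cnorm Q (f n \<ominus>\<^bsub>Q\<^esub> L)) \<longlonglongrightarrow> 0"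
      by (rule quot_complete)
  qed (auto simp: carrier_quot cnorm_cls cut_add cut_mult cut_smult mult_assoc mult_l_distr
      mult_r_distr smult_mult_l smult_mult_r adj_add adj_mult adj_smult cnorm_triangle cnorm_mult cnorm_smult)
  show "unital_cstar_algebra_axioms Q"
    by (rule unital_cstar_algebra_axioms.intro) (auto simp: carrier_quot one_quot)
qed

end

section \<open>The left inverse hull\<close>

definition idm :: "'s set \<Rightarrow> ('s \<rightharpoonup> 's)" where
  "idm X = (\<lambda>x. if x \<in> X then Some x else None)"

lemma idm_Some [simp]: "idm X x = Some y \<longleftrightarrow> x \<in> X \<and> y = x"
  by (auto simp: idm_def)

lemma map_eqI: "(\<And>x y. f x = Some y \<longleftrightarrow> g x = Some y) \<Longrightarrow> f = g"
  by (rule ext) (metis option.exhaust)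

lemma idm_comp: "idm X \<circ>\<^sub>m idm Y = idm (X \<inter> Y)"
  by (rule map_eqI) (auto simp: map_comp_Some_iff)

lemma idm_empty [simp]: "idm {} = Map.empty"
  by (simp add: idm_def)

definition pinj :: "('s \<rightharpoonup> 's) \<Rightarrow> bool" where
  "pinj f \<longleftrightarrow> (\<forall>x y z. f x = Some z \<longrightarrow> f y = Some z \<longrightarrow> x = y)"

text \<open>Injectivity makes the description in \<open>pinverse\<close> denote the unique
  preimage.\<close>

lemma pinverse_Some: assumes "pinj f" shows "pinverse f y = Some x \<longleftrightarrow> f x = Some y"
proof -
  have "(THE x. f x = Some y) = x" if "f x = Some y" for x
    using that assms by (intro the_equality) (auto simp: pinj_def)
  then show ?thesis by (auto simp: pinverse_def ran_def)
qed

lemma pinj_comp: "\<lbrakk>pinj f; pinj g\<rbrakk> \<Longrightarrow> pinj (f \<circ>\<^sub>m g)"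
  unfolding pinj_def map_comp_Some_iff by metis

lemma pinj_pinverse: "pinj f \<Longrightarrow> pinj (pinverse f)"
  unfolding pinj_def[of "pinverse f"] by (auto simp: pinverse_Some)

lemma pinverse_comp:
  "\<lbrakk>pinj f; pinj g\<rbrakk> \<Longrightarrow> pinverse (f \<circ>\<^sub>m g) = pinverse g \<circ>\<^sub>m pinverse f"
  by (rule map_eqI) (auto simp: map_comp_Some_iff pinverse_Some pinj_comp)

lemma pinverse_pinverse: "pinj f \<Longrightarrow> pinverse (pinverse f) = f"
  by (rule map_eqI) (auto simp: pinverse_Some pinj_pinverse)

lemma comp_pinverse_comp: "pinj f \<Longrightarrow> f \<circ>\<^sub>m pinverse f \<circ>\<^sub>m f = f"
  by (rule map_eqI) (auto simp: map_comp_Some_iff pinverse_Some pinj_def)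

lemma pinverse_empty [simp]: "pinverse Map.empty = Map.empty"
  by (rule map_eqI) (simp add: pinverse_Some pinj_def)

locale left_cancellative_monoid = monoid S for S (structure) +
  assumes left_canc: "left_cancellative S"
begin

abbreviation "H \<equiv> left_hull_carrier S"

lemma cancel [simp]:
  "\<lbrakk>s \<in> carrier S; r \<in> carrier S; t \<in> carrier S\<rbrakk> \<Longrightarrow> s \<otimes> r = s \<otimes> t \<longleftrightarrow> r = t"
  using left_canc unfolding left_cancellative_def by blast

lemma ltrans_Some [simp]: "ltrans S s x = Some y \<longleftrightarrow> x \<in> carrier S \<and> y = s \<otimes> x"
  by (auto simp: ltrans_def)

lemma pinj_ltrans [simp]: "s \<in> carrier S \<Longrightarrow> pinj (ltrans S s)"
  by (auto simp: pinj_def)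

lemma hull_pinj: "f \<in> H \<Longrightarrow> pinj f"
  by (induction rule: left_hull_carrier.induct) (auto simp: pinj_comp pinj_pinverse)

lemma hull_carrier: "f \<in> H \<Longrightarrow> f x = Some y \<Longrightarrow> x \<in> carrier S \<and> y \<in> carrier S"
proof (induction arbitrary: x y rule: left_hull_carrier.induct)
  case (inverse f)
  then show ?case by (auto simp: pinverse_Some hull_pinj)
qed (auto simp: map_comp_Some_iff)

lemma ltrans_one: "ltrans S \<one> = idm (carrier S)"
  by (rule map_eqI) auto

lemma ltrans_one_comp: "f \<in> H \<Longrightarrow> ltrans S \<one> \<circ>\<^sub>m f = f" "f \<in> H \<Longrightarrow> f \<circ>\<^sub>m ltrans S \<one> = f"
  unfolding ltrans_one by (rule map_eqI, auto simp: map_comp_Some_iff dest: hull_carrier)+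

lemma ltrans_mult:
  "\<lbrakk>s \<in> carrier S; t \<in> carrier S\<rbrakk> \<Longrightarrow> ltrans S (s \<otimes> t) = ltrans S s \<circ>\<^sub>m ltrans S t"
  by (rule map_eqI) (auto simp: map_comp_Some_iff m_assoc)

lemma pinverse_ltrans_comp: "s \<in> carrier S \<Longrightarrow> pinverse (ltrans S s) \<circ>\<^sub>m ltrans S s = ltrans S \<one>"
  by (rule map_eqI) (auto simp: map_comp_Some_iff pinverse_Some)

text \<open>Together with the next lemma, this turns the operations sX and t^-1 X on ideals into
  conjugations of identity maps, which puts the identity map of every constructible ideal into the
  hull.\<close>

lemma ltrans_conj_idm:
  "\<lbrakk>s \<in> carrier S; X \<subseteq> carrier S\<rbrakk>
    \<Longrightarrow> ltrans S s \<circ>\<^sub>m idm X \<circ>\<^sub>m pinverse (ltrans S s) = idm (s <# X)"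
  by (rule map_eqI) (auto simp: map_comp_Some_iff pinverse_Some l_coset_def)

lemma pinverse_ltrans_conj_idm:
  "t \<in> carrier S \<Longrightarrow> pinverse (ltrans S t) \<circ>\<^sub>m idm X \<circ>\<^sub>m ltrans S t = idm (lpre S t X)"
  by (rule map_eqI) (auto simp: map_comp_Some_iff pinverse_Some lpre_def)

lemma idm_hull_carrier: "idm (carrier S) \<in> H"
  unfolding ltrans_one[symmetric] by (rule left_hull_carrier.gen) simp

lemma idm_hull_coset: "\<lbrakk>s \<in> carrier S; X \<subseteq> carrier S; idm X \<in> H\<rbrakk> \<Longrightarrow> idm (s <# X) \<in> H"
  unfolding ltrans_conj_idm[symmetric] by (intro left_hull_carrier.intros)

lemma idm_hull_lpre: "\<lbrakk>t \<in> carrier S; idm X \<in> H\<rbrakk> \<Longrightarrow> idm (lpre S t X) \<in> H"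
  unfolding pinverse_ltrans_conj_idm[symmetric] by (intro left_hull_carrier.intros)

lemma coset_subset: "\<lbrakk>s \<in> carrier S; X \<subseteq> carrier S\<rbrakk> \<Longrightarrow> s <# X \<subseteq> carrier S"
  by (auto simp: l_coset_def)

lemma idm_basic_ideal: "X \<in> basic_ideals S \<Longrightarrow> X \<subseteq> carrier S \<and> idm X \<in> H"
proof (induction rule: basic_ideals.induct)
  case (base s t)
  then show ?case
    using idm_hull_lpre[OF _ idm_hull_coset[OF _ _ idm_hull_carrier]] by (auto simp: lpre_def)
next
  case (step s t X)
  then show ?case using idm_hull_lpre[OF _ idm_hull_coset] by (auto simp: lpre_def)
qed

lemma constructible_ideal_induct [consumes 1, case_names basic inter]:
  assumes "X \<in> constructible_ideals S"
    and "\<And>X. X \<in> basic_ideals S \<Longrightarrow> P X" "\<And>X Y. \<lbrakk>P X; P Y\<rbrakk> \<Longrightarrow> P (X \<inter> Y)"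
  shows "P X"
proof -
  obtain F where F: "finite F" "F \<noteq> {}" "F \<subseteq> basic_ideals S" "X = \<Inter>F"
    using assms(1) by (auto simp: constructible_ideals_def)
  from F(1-3) have "P (\<Inter>F)"
    by (induction rule: finite_ne_induct) (auto intro: assms(2,3))
  then show ?thesis using F by simp
qed

lemma idm_constructible: "X \<in> constructible_ideals S \<Longrightarrow> X \<subseteq> carrier S \<and> idm X \<in> H"
proof (induction rule: constructible_ideal_induct)
  case (inter X Y)
  then show ?case using left_hull_carrier.comp[of "idm X" S "idm Y"] by (auto simp: idm_comp)
qed (rule idm_basic_ideal)

lemma principal_constructible:
  assumes "s \<in> carrier S" shows "s <# carrier S \<in> constructible_ideals S"
proof -
  \<comment> \<open>A principal ideal is a basic one by taking the preimage under 1.\<close>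
  have "s <# carrier S = lpre S \<one> (s <# carrier S)"
    using assms by (auto simp: lpre_def l_coset_def)
  then have "s <# carrier S \<in> basic_ideals S" using basic_ideals.base[of s S \<one>] assms by simp
  then show ?thesis
    unfolding constructible_ideals_def by (auto intro!: exI[of _ "{s <# carrier S}"])
qed

section \<open>Fractions: the maps tr \<mapsto> sr from tS onto sS\<close>

definition frac :: "'a \<Rightarrow> 'a \<Rightarrow> ('a \<rightharpoonup> 'a)" where
  "frac s t = ltrans S s \<circ>\<^sub>m pinverse (ltrans S t)"

lemma frac_Some: "t \<in> carrier S \<Longrightarrow>
    frac s t x = Some y \<longleftrightarrow> (\<exists>r\<in>carrier S. x = t \<otimes> r \<and> y = s \<otimes> r)"
  by (auto simp: frac_def map_comp_Some_iff pinverse_Some)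

lemma frac_nonempty: "t \<in> carrier S \<Longrightarrow> frac s t \<noteq> Map.empty"
proof
  assume "t \<in> carrier S" "frac s t = Map.empty"
  with frac_Some[of t s "t \<otimes> \<one>" "s \<otimes> \<one>"] show False by (metis one_closed option.distinct(1))
qed

text \<open>Evaluation at t and at q gives t = qx, s = px and q = ty; cancelling q in q = qxy yields
  xy = 1, hence xS = S. Two representations of a fraction thus differ by such a factor x.\<close>

lemma frac_eqD:
  assumes st: "s \<in> carrier S" "t \<in> carrier S" "p \<in> carrier S" "q \<in> carrier S"
    and eq: "frac s t = frac p q"
  obtains x where "x \<in> carrier S" "x <# carrier S = carrier S" "s = p \<otimes> x" "t = q \<otimes> x"
proof -
  have "frac s t t = Some s" using st by (auto simp: frac_Some intro: bexI[of _ \<one>])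
  then obtain x where x: "x \<in> carrier S" "t = q \<otimes> x" "s = p \<otimes> x"
    using st by (auto simp: eq frac_Some)
  have "frac p q q = Some p" using st by (auto simp: frac_Some intro: bexI[of _ \<one>])
  then obtain y where y: "y \<in> carrier S" "q = t \<otimes> y"
    using st by (auto simp: eq[symmetric] frac_Some)
  have "q \<otimes> (x \<otimes> y) = q \<otimes> \<one>" using x y st by (metis m_assoc r_one)
  then have xy: "x \<otimes> y = \<one>" using x y st by (subst (asm) cancel) simp_all
  have "r \<in> x <# carrier S" if "r \<in> carrier S" for r
  proof -
    have "r = x \<otimes> (y \<otimes> r)" using x y xy that by (simp add: m_assoc[symmetric])
    then show ?thesis using y that by (auto simp: l_coset_def)
  qed
  then have "x <# carrier S = carrier S" using coset_subset[of x "carrier S"] x by auto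
  with x that show thesis by blast
qed

lemma frac_one: "s \<in> carrier S \<Longrightarrow> frac s \<one> = ltrans S s"
  by (rule map_eqI) (auto simp: frac_Some)

lemma frac_self: "s \<in> carrier S \<Longrightarrow> frac s s = idm (s <# carrier S)"
  by (rule map_eqI) (auto simp: frac_Some l_coset_def)

lemma pinverse_frac: "\<lbrakk>s \<in> carrier S; t \<in> carrier S\<rbrakk> \<Longrightarrow> pinverse (frac s t) = frac t s"
  by (simp add: frac_def pinverse_comp pinj_pinverse pinverse_pinverse)

lemma mult_in_coset:
  "\<lbrakk>s \<in> carrier S; r \<in> carrier S\<rbrakk> \<Longrightarrow> s \<otimes> r \<in> s <# carrier S"
  by (auto simp: l_coset_def)

lemma frac_comp_disjoint:
  assumes "s \<in> carrier S" "t \<in> carrier S" "p \<in> carrier S" "q \<in> carrier S"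
    and "(t <# carrier S) \<inter> (p <# carrier S) = {}"
  shows "frac s t \<circ>\<^sub>m frac p q = Map.empty"
proof (rule map_eqI)
  fix x y
  have "t \<otimes> r \<noteq> p \<otimes> r'" if "r \<in> carrier S" "r' \<in> carrier S" for r r'
    using assms(5) that mult_in_coset[of t r] mult_in_coset[of p r'] assms(2,3) by auto
  then show "(frac s t \<circ>\<^sub>m frac p q) x = Some y \<longleftrightarrow> Map.empty x = Some y"
    using assms(1-4) by (auto simp: map_comp_Some_iff frac_Some dest: sym)
qed

text \<open>The common multiple ta = pb generates the overlap of the domain tS of the outer map with
  the range pS of the inner one. Cancellation shows that the composite is defined exactly on qbS,
  where it sends qbw to saw.\<close>

lemma frac_comp:
  assumes S: "s \<in> carrier S" "t \<in> carrier S" "p \<in> carrier S" "q \<in> carrier S"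
    "a \<in> carrier S" "b \<in> carrier S"
    and ab: "t \<otimes> a = p \<otimes> b"
    and int: "(t <# carrier S) \<inter> (p <# carrier S) = (t \<otimes> a) <# carrier S"
  shows "frac s t \<circ>\<^sub>m frac p q = frac (s \<otimes> a) (q \<otimes> b)"
proof (rule map_eqI)
  fix x y
  show "(frac s t \<circ>\<^sub>m frac p q) x = Some y \<longleftrightarrow> frac (s \<otimes> a) (q \<otimes> b) x = Some y"
  proof
    assume "(frac s t \<circ>\<^sub>m frac p q) x = Some y"
    then obtain r r' where r: "r \<in> carrier S" "r' \<in> carrier S" "x = q \<otimes> r" "p \<otimes> r = t \<otimes> r'" "y = s \<otimes> r'"
      using S by (auto simp: map_comp_Some_iff frac_Some)
    have "t \<otimes> r' \<in> (t \<otimes> a) <# carrier S"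
      using int mult_in_coset[of t r'] mult_in_coset[of p r] r S by auto
    then obtain w where w: "w \<in> carrier S" "t \<otimes> r' = t \<otimes> a \<otimes> w" by (auto simp: l_coset_def)
    then have "t \<otimes> r' = t \<otimes> (a \<otimes> w)" using S by (simp add: m_assoc)
    then have 1: "r' = a \<otimes> w" using S r w(1) by (subst (asm) cancel) simp_all
    have "p \<otimes> r = p \<otimes> (b \<otimes> w)" using S r(4) w by (simp add: ab m_assoc)
    then have 2: "r = b \<otimes> w" using S r w(1) by (subst (asm) cancel) simp_all
    show "frac (s \<otimes> a) (q \<otimes> b) x = Some y"
      using S w(1) unfolding r(3,5) 1 2 by (auto simp: frac_Some m_assoc intro!: bexI[of _ w])
  next
    assume "frac (s \<otimes> a) (q \<otimes> b) x = Some y"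
    then obtain w where w: "w \<in> carrier S" "x = q \<otimes> b \<otimes> w" "y = s \<otimes> a \<otimes> w"
      using S by (auto simp: frac_Some)
    have "p \<otimes> (b \<otimes> w) = t \<otimes> (a \<otimes> w)" using S w(1) ab by (simp add: m_assoc[symmetric])
    moreover have "frac p q x = Some (p \<otimes> (b \<otimes> w))"
      using S w by (auto simp: frac_Some m_assoc intro!: bexI[of _ "b \<otimes> w"])
    moreover have "frac s t (t \<otimes> (a \<otimes> w)) = Some y"
      using S w by (auto simp: frac_Some m_assoc intro!: bexI[of _ "a \<otimes> w"])
    ultimately show "(frac s t \<circ>\<^sub>m frac p q) x = Some y" by (simp add: map_comp_Some_iff)
  qed
qed

section \<open>Consequences of Clifford's condition\<close>

context
  assumes clifford: "clifford S"
begin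

text \<open>A generator r of the overlap lies in both ideals, so r = ta = pb is a least common right
  multiple.\<close>

lemma clifford_cases:
  assumes "t \<in> carrier S" "p \<in> carrier S"
  obtains (disjoint) "(t <# carrier S) \<inter> (p <# carrier S) = {}"
    | (meet) a b where "a \<in> carrier S" "b \<in> carrier S" "t \<otimes> a = p \<otimes> b"
        "(t <# carrier S) \<inter> (p <# carrier S) = (t \<otimes> a) <# carrier S"
proof (cases "(t <# carrier S) \<inter> (p <# carrier S) = {}")
  case False
  then obtain r where r: "r \<in> carrier S" "(t <# carrier S) \<inter> (p <# carrier S) = r <# carrier S"
    using clifford assms unfolding clifford_def by blast
  have "r \<in> r <# carrier S" using mult_in_coset[of r \<one>] r by simp
  then have "r \<in> t <# carrier S" "r \<in> p <# carrier S" using r(2) by auto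
  then obtain a b where "a \<in> carrier S" "b \<in> carrier S" "r = t \<otimes> a" "r = p \<otimes> b"
    by (auto simp: l_coset_def)
  with r(2) show thesis by (intro meet[of a b]) auto
qed (rule disjoint)

text \<open>The generators are fractions with denominator 1, inversion swaps numerator and
  denominator, and a product of two fractions is empty or again a fraction.\<close>

lemma hull_clifford:
  "f \<in> H \<Longrightarrow> f = Map.empty \<or> (\<exists>s\<in>carrier S. \<exists>t\<in>carrier S. f = frac s t)"
proof (induction rule: left_hull_carrier.induct)
  case (gen s)
  then show ?case using frac_one[of s] by (metis one_closed)
next
  case (comp f g)
  show ?case
  proof (cases "f = Map.empty \<or> g = Map.empty")
    case True
    then have "f \<circ>\<^sub>m g = Map.empty" by (intro map_eqI) (auto simp: map_comp_Some_iff)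
    then show ?thesis by simp
  next
    case False
    with comp.IH obtain s t p q where S: "s \<in> carrier S" "t \<in> carrier S" "p \<in> carrier S" "q \<in> carrier S"
      and fg: "f = frac s t" "g = frac p q" by blast
    from S(2,3) show ?thesis
    proof (cases rule: clifford_cases)
      case disjoint
      then show ?thesis using frac_comp_disjoint[OF S] by (simp add: fg)
    next
      case (meet a b)
      then have "f \<circ>\<^sub>m g = frac (s \<otimes> a) (q \<otimes> b)" using frac_comp[OF S meet(1-4)] by (simp add: fg)
      then show ?thesis using S meet(1,2) by blast
    qed
  qed
next
  case (inverse f)
  then show ?case using pinverse_frac by (metis pinverse_empty)
qed

text \<open>If tS and rS overlap in taS, cancelling t identifies the preimage of rS with aS.\<close>

lemma lpre_principal:
  assumes "t \<in> carrier S" "r \<in> carrier S"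
  shows "lpre S t (r <# carrier S) = {} \<or> (\<exists>a\<in>carrier S. lpre S t (r <# carrier S) = a <# carrier S)"
  using assms
proof (cases rule: clifford_cases)
  case disjoint
  have "lpre S t (r <# carrier S) = {}"
  proof (rule ccontr)
    assume "lpre S t (r <# carrier S) \<noteq> {}"
    then obtain x where "x \<in> carrier S" "t \<otimes> x \<in> r <# carrier S" by (auto simp: lpre_def)
    with disjoint mult_in_coset[of t x] assms show False by auto
  qed
  then show ?thesis by simp
next
  case (meet a b)
  have "lpre S t (r <# carrier S) = a <# carrier S"
  proof (intro equalityI subsetI)
    fix x assume "x \<in> lpre S t (r <# carrier S)"
    then have x: "x \<in> carrier S" "t \<otimes> x \<in> r <# carrier S" by (auto simp: lpre_def)
    then have "t \<otimes> x \<in> (t \<otimes> a) <# carrier S"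
      using meet(4) mult_in_coset[of t x] assms by auto
    then obtain w where w: "w \<in> carrier S" "t \<otimes> x = t \<otimes> a \<otimes> w" by (auto simp: l_coset_def)
    have "t \<otimes> x = t \<otimes> (a \<otimes> w)"
      by (rule trans[OF w(2) m_assoc[OF assms(1) meet(1) w(1)]])
    then have "x = a \<otimes> w" using assms(1) meet(1) x(1) w(1) by (metis cancel m_closed)
    then show "x \<in> a <# carrier S" using mult_in_coset meet(1) w(1) by simp
  next
    fix x assume "x \<in> a <# carrier S"
    then obtain w where w: "w \<in> carrier S" "x = a \<otimes> w" by (auto simp: l_coset_def)
    have "t \<otimes> x = r \<otimes> (b \<otimes> w)"
      using w meet assms by (simp add: m_assoc[symmetric])
    also have "\<dots> \<in> r <# carrier S" using w meet assms by (intro mult_in_coset) simp_all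
    finally have "t \<otimes> x \<in> r <# carrier S" .
    moreover have "x \<in> carrier S" using w meet by simp
    ultimately show "x \<in> lpre S t (r <# carrier S)" by (simp add: lpre_def)
  qed
  with meet(1) show ?thesis by blast
qed

lemma constructible_clifford:
  "X \<in> constructible_ideals S \<Longrightarrow> X = {} \<or> (\<exists>r\<in>carrier S. X = r <# carrier S)"
proof (induction rule: constructible_ideal_induct)
  case (basic X)
  then show ?case
  proof (induction rule: basic_ideals.induct)
    case (base s t)
    then show ?case using lpre_principal by simp
  next
    case (step s t X)
    show ?case
    proof (cases "X = {}")
      case True
      then show ?thesis by (simp add: lpre_def l_coset_def)
    next
      case False
      with step obtain r where "r \<in> carrier S" "X = r <# carrier S" by blast
      then have "s <# X = (s \<otimes> r) <# carrier S"
        using step by (auto simp: l_coset_def m_assoc)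
      then show ?thesis using lpre_principal[of t "s \<otimes> r"] step \<open>r \<in> carrier S\<close> by simp
    qed
  qed
next
  case (inter X Y)
  show ?case
  proof (cases "X \<inter> Y = {}")
    case False
    with inter obtain r r' where "r \<in> carrier S" "r' \<in> carrier S" "X = r <# carrier S" "Y = r' <# carrier S"
      by blast
    then show ?thesis using clifford unfolding clifford_def by blast
  qed simp
qed

end

end

section \<open>Replacing the field \<open>one\<close>\<close>

text \<open>
  The unit of the full C*-algebra of the left inverse hull is the image of \<open>\<lambda>\<^sub>1\<close>, whereas its
  field \<open>one\<close> is arbitrary.
\<close>

lemma cstar_algebra_one_update:
  assumes "cstar_algebra A" shows "cstar_algebra (A\<lparr>one := u\<rparr>)"
  using assms
  unfolding cstar_algebra_def cstar_algebra_axioms_def module_def module_axioms_def abelian_group_def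
    abelian_group_axioms_def abelian_monoid_def a_minus_def a_inv_def
  by simp

lemma star_hom_one_update [simp]:
  "star_hom (A\<lparr>one := u\<rparr>) B \<phi> = star_hom A B \<phi>" "star_hom A (B\<lparr>one := w\<rparr>) \<phi> = star_hom A B \<phi>"
  by (simp_all add: star_hom_def)

lemma cstar_generated_by_one_update [simp]:
  "cstar_generated_by (A\<lparr>one := u\<rparr>) X = cstar_generated_by A X"
  by (simp add: cstar_generated_by_def cstar_subalgebra_def a_minus_def a_inv_def)

lemma pi_representation_one_update [simp]:
  "pi_representation P (A\<lparr>one := u\<rparr>) \<pi> = pi_representation P A \<pi>"
  by (simp add: pi_representation_def hom_def)

lemma a_r_coset_one_update [simp]:
  fixes A :: "'a cstar" shows "N +>\<^bsub>A\<lparr>one := u\<rparr>\<^esub> x = N +>\<^bsub>A\<^esub> x"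
  by (simp add: a_r_coset_def')

lemma cstar_quot_one_update:
  "cstar_quot (A\<lparr>one := u\<rparr>) N = (cstar_quot A N)\<lparr>one := N +>\<^bsub>A\<^esub> u\<rparr>"
  by (simp add: cstar_quot_def FactRing_def A_RCOSETS_def' rcoset_mult_def a_r_coset_def'
      set_add_def' fun_eq_iff)

section \<open>The reduced C*-algebra of the left inverse hull\<close>

locale hull_algebra = left_cancellative_monoid S + C: unital_cstar_algebra C
  for S :: "('s, 'm) monoid_scheme" (structure) and C :: "'c cstar" +
  fixes \<iota> :: "('s \<rightharpoonup> 's) \<Rightarrow> 'c"
  assumes rep: "pi_representation (left_hull S) C \<iota>"
    and gen: "cstar_generated_by C (\<iota> ` H)"
    and unit: "\<one>\<^bsub>C\<^esub> = \<iota> (ltrans S \<one>)"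
begin

lemma rep_closed [simp]: "f \<in> H \<Longrightarrow> \<iota> f \<in> carrier C"
  and rep_mult: "\<lbrakk>f \<in> H; g \<in> H\<rbrakk> \<Longrightarrow> \<iota> (f \<circ>\<^sub>m g) = \<iota> f \<otimes>\<^bsub>C\<^esub> \<iota> g"
  and rep_partial_isometry: "f \<in> H \<Longrightarrow> \<iota> f \<otimes>\<^bsub>C\<^esub> adj C (\<iota> f) \<otimes>\<^bsub>C\<^esub> \<iota> f = \<iota> f"
  using rep unfolding pi_representation_def by (auto simp: left_hull_def hom_def)

text \<open>The images of f and of its inverse are generalized inverses of each other, and their
  products are partial isometries because the hull is closed under composition. This forces one to
  be the adjoint of the other.\<close>

lemma rep_pinverse:
  assumes f: "f \<in> H" shows "\<iota> (pinverse f) = adj C (\<iota> f)"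
proof (rule C.partial_isometry_inverse_eq_adj)
  let ?g = "pinverse f"
  have g: "?g \<in> H" and p: "pinj f" "pinj ?g" using f by (auto simp: hull_pinj pinj_pinverse intro: left_hull_carrier.inverse)
  show "\<iota> f \<otimes>\<^bsub>C\<^esub> \<iota> ?g \<otimes>\<^bsub>C\<^esub> \<iota> f = \<iota> f"
    using f g p comp_pinverse_comp[of f] by (simp add: rep_mult[symmetric] left_hull_carrier.comp)
  show "\<iota> ?g \<otimes>\<^bsub>C\<^esub> \<iota> f \<otimes>\<^bsub>C\<^esub> \<iota> ?g = \<iota> ?g"
    using f g p comp_pinverse_comp[of ?g]
    by (simp add: rep_mult[symmetric] left_hull_carrier.comp pinverse_pinverse)
  show "\<iota> f \<otimes>\<^bsub>C\<^esub> \<iota> ?g \<otimes>\<^bsub>C\<^esub> adj C (\<iota> f \<otimes>\<^bsub>C\<^esub> \<iota> ?g) \<otimes>\<^bsub>C\<^esub> (\<iota> f \<otimes>\<^bsub>C\<^esub> \<iota> ?g) = \<iota> f \<otimes>\<^bsub>C\<^esub> \<iota> ?g"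
    using f g rep_partial_isometry[of "f \<circ>\<^sub>m ?g"] by (simp add: rep_mult left_hull_carrier.comp)
  show "\<iota> ?g \<otimes>\<^bsub>C\<^esub> \<iota> f \<otimes>\<^bsub>C\<^esub> adj C (\<iota> ?g \<otimes>\<^bsub>C\<^esub> \<iota> f) \<otimes>\<^bsub>C\<^esub> (\<iota> ?g \<otimes>\<^bsub>C\<^esub> \<iota> f) = \<iota> ?g \<otimes>\<^bsub>C\<^esub> \<iota> f"
    using f g rep_partial_isometry[of "?g \<circ>\<^sub>m f"] by (simp add: rep_mult left_hull_carrier.comp)
qed (use f in \<open>auto simp: rep_partial_isometry left_hull_carrier.inverse\<close>)

text \<open>With the default zero, the ideal to be divided out is the span of z in both
  cases.\<close>

definition z :: 'c where
  "z = (if Map.empty \<in> H then \<iota> Map.empty else \<zero>\<^bsub>C\<^esub>)"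

lemma z_closed [simp]: "z \<in> carrier C"
  by (simp add: z_def)

lemma z_adj: "adj C z = z"
  using rep_pinverse[of Map.empty] by (simp add: z_def)

lemma z_idem: "z \<otimes>\<^bsub>C\<^esub> z = z"
  using rep_mult[of Map.empty Map.empty] by (simp add: z_def)

lemma rep_z: "f \<in> H \<Longrightarrow> \<iota> f \<otimes>\<^bsub>C\<^esub> z = z" if "Map.empty \<in> H"
proof -
  assume "f \<in> H"
  moreover have "f \<circ>\<^sub>m Map.empty = Map.empty" by (rule map_eqI) (simp add: map_comp_Some_iff)
  ultimately show ?thesis using that rep_mult[of f Map.empty] by (simp add: z_def)
qed

lemma z_rep: "f \<in> H \<Longrightarrow> z \<otimes>\<^bsub>C\<^esub> \<iota> f = z" if "Map.empty \<in> H"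
proof -
  assume "f \<in> H"
  moreover have "Map.empty \<circ>\<^sub>m f = Map.empty" by (rule map_eqI) (simp add: map_comp_Some_iff)
  ultimately show ?thesis using that rep_mult[of Map.empty f] by (simp add: z_def)
qed

text \<open>The empty map absorbs every map, so generators act on z as 1, and acting on z by a
  scalar survives all operations and limits. For nonzero z the scalar is the character belonging to
  the trivial representation. Having one scalar for both sides shows that z is central and that the
  ideal it generates is its span.\<close>

lemma mult_z_eq_smult:
  assumes "x \<in> carrier C"
  shows "\<exists>c. x \<otimes>\<^bsub>C\<^esub> z = c \<odot>\<^bsub>C\<^esub> z \<and> z \<otimes>\<^bsub>C\<^esub> x = c \<odot>\<^bsub>C\<^esub> z"
proof (cases "z = \<zero>\<^bsub>C\<^esub>")
  case True
  then show ?thesis using assms by simp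
next
  case False
  then have zH: "Map.empty \<in> H" by (auto simp: z_def split: if_splits)
  have zn: "cnorm C z > 0" using False C.cnorm_eq_zero[of z] C.cnorm_nonneg[of z] by (simp add: less_le)
  show ?thesis using gen assms
  proof (induction rule: C.generated_induct)
    case (gen x)
    then show ?case using zH by (intro exI[of _ 1]) (auto simp: rep_z z_rep)
  next
    case zero
    show ?case by (intro exI[of _ 0]) simp
  next
    case (add x y)
    then obtain c d where "x \<otimes>\<^bsub>C\<^esub> z = c \<odot>\<^bsub>C\<^esub> z" "z \<otimes>\<^bsub>C\<^esub> x = c \<odot>\<^bsub>C\<^esub> z"
      "y \<otimes>\<^bsub>C\<^esub> z = d \<odot>\<^bsub>C\<^esub> z" "z \<otimes>\<^bsub>C\<^esub> y = d \<odot>\<^bsub>C\<^esub> z" by blast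
    then show ?case using add
      by (intro exI[of _ "c + d"]) (simp add: C.mult_l_distr C.mult_r_distr C.smult_add_left)
  next
    case (smult k x)
    then obtain c where "x \<otimes>\<^bsub>C\<^esub> z = c \<odot>\<^bsub>C\<^esub> z" "z \<otimes>\<^bsub>C\<^esub> x = c \<odot>\<^bsub>C\<^esub> z" by blast
    then show ?case using smult
      by (intro exI[of _ "k * c"]) (simp add: C.smult_mult_l C.smult_mult_r)
  next
    case (mult x y)
    then obtain c d where cd: "x \<otimes>\<^bsub>C\<^esub> z = c \<odot>\<^bsub>C\<^esub> z" "z \<otimes>\<^bsub>C\<^esub> x = c \<odot>\<^bsub>C\<^esub> z"
      "y \<otimes>\<^bsub>C\<^esub> z = d \<odot>\<^bsub>C\<^esub> z" "z \<otimes>\<^bsub>C\<^esub> y = d \<odot>\<^bsub>C\<^esub> z" by blast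
    have "x \<otimes>\<^bsub>C\<^esub> y \<otimes>\<^bsub>C\<^esub> z = (c * d) \<odot>\<^bsub>C\<^esub> z"
      using mult(1,2) by (simp add: C.mult_assoc C.smult_mult_r cd mult.commute)
    moreover have "z \<otimes>\<^bsub>C\<^esub> (x \<otimes>\<^bsub>C\<^esub> y) = (c * d) \<odot>\<^bsub>C\<^esub> z"
      using mult(1,2) by (simp add: C.mult_assoc[symmetric] C.smult_mult_l cd)
    ultimately show ?case by blast
  next
    case (adj x)
    then obtain c where c: "x \<otimes>\<^bsub>C\<^esub> z = c \<odot>\<^bsub>C\<^esub> z" "z \<otimes>\<^bsub>C\<^esub> x = c \<odot>\<^bsub>C\<^esub> z" by blast
    have "adj C x \<otimes>\<^bsub>C\<^esub> z = adj C (z \<otimes>\<^bsub>C\<^esub> x)" "z \<otimes>\<^bsub>C\<^esub> adj C x = adj C (x \<otimes>\<^bsub>C\<^esub> z)"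
      using adj(1) by (simp_all add: C.adj_mult z_adj)
    then show ?case by (intro exI[of _ "cnj c"]) (simp add: c C.adj_smult z_adj)
  next
    case (lim f l)
    then obtain c where c: "\<And>n. f n \<otimes>\<^bsub>C\<^esub> z = c n \<odot>\<^bsub>C\<^esub> z" "\<And>n. z \<otimes>\<^bsub>C\<^esub> f n = c n \<odot>\<^bsub>C\<^esub> z" by metis
    \<comment> \<open>The scalars are merely chosen for each n. As z has positive norm, their
      differences are controlled by those of \<open>f\<close>, so they converge.\<close>
    have bound: "dist (c m) (c n) \<le> cnorm C (f m \<ominus>\<^bsub>C\<^esub> l) + cnorm C (f n \<ominus>\<^bsub>C\<^esub> l)" for m n
    proof -
      have "(c m - c n) \<odot>\<^bsub>C\<^esub> z = c m \<odot>\<^bsub>C\<^esub> z \<ominus>\<^bsub>C\<^esub> c n \<odot>\<^bsub>C\<^esub> z"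
        using C.smult_add_left[of z "c m" "- c n"] by (simp add: C.diff_smult)
      also have "\<dots> = (f m \<ominus>\<^bsub>C\<^esub> f n) \<otimes>\<^bsub>C\<^esub> z" using lim(1) by (simp add: C.diff_mult c)
      finally have "dist (c m) (c n) * cnorm C z = cnorm C ((f m \<ominus>\<^bsub>C\<^esub> f n) \<otimes>\<^bsub>C\<^esub> z)"
        by (metis C.cnorm_smult dist_norm z_closed)
      also have "\<dots> \<le> cnorm C (f m \<ominus>\<^bsub>C\<^esub> f n) * cnorm C z" using lim(1) by (simp add: C.cnorm_mult)
      finally have "dist (c m) (c n) \<le> cnorm C (f m \<ominus>\<^bsub>C\<^esub> f n)" using zn by simp
      also have "\<dots> \<le> cnorm C (f m \<ominus>\<^bsub>C\<^esub> l) + cnorm C (l \<ominus>\<^bsub>C\<^esub> f n)"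
        using lim(1,2) by (simp add: C.cnorm_diff_triangle)
      finally show ?thesis using lim(1,2) by (simp add: C.cnorm_diff_comm[of l])
    qed
    have "Cauchy c"
    proof (rule metric_CauchyI)
      fix \<epsilon> :: real assume "\<epsilon> > 0"
      then have "\<epsilon> / 2 > 0" by simp
      from order_tendstoD(2)[OF lim(3)[unfolded C.lim_to_def] this]
      obtain M where M: "\<And>n. n \<ge> M \<Longrightarrow> cnorm C (f n \<ominus>\<^bsub>C\<^esub> l) < \<epsilon> / 2"
        unfolding eventually_sequentially by blast
      show "\<exists>M. \<forall>m\<ge>M. \<forall>n\<ge>M. dist (c m) (c n) < \<epsilon>"
      proof (intro exI allI impI)
        fix m n assume "M \<le> m" "M \<le> n"
        then show "dist (c m) (c n) < \<epsilon>" using bound[of m n] M[of m] M[of n] by simp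
      qed
    qed
    then have "convergent c" by (rule Cauchy_convergent)
    then obtain d where d: "c \<longlonglongrightarrow> d" unfolding convergent_def by blast
    have "C.lim_to (\<lambda>n. c n \<odot>\<^bsub>C\<^esub> z) (d \<odot>\<^bsub>C\<^esub> z)"
    proof (rule C.lim_to_bound)
      show "(\<lambda>n. dist (c n) d * cnorm C z) \<longlonglongrightarrow> 0"
        by (rule tendsto_mult_left_zero[OF tendsto_dist_iff[THEN iffD1, OF d]])
      fix n
      have "c n \<odot>\<^bsub>C\<^esub> z \<ominus>\<^bsub>C\<^esub> d \<odot>\<^bsub>C\<^esub> z = (c n - d) \<odot>\<^bsub>C\<^esub> z"
        using C.smult_add_left[of z "c n" "- d"] by (simp add: C.diff_smult)
      then show "cnorm C (c n \<odot>\<^bsub>C\<^esub> z \<ominus>\<^bsub>C\<^esub> d \<odot>\<^bsub>C\<^esub> z) \<le> dist (c n) d * cnorm C z"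
        by (simp add: C.cnorm_smult dist_norm)
    qed auto
    note dz = this
    have "l \<otimes>\<^bsub>C\<^esub> z = d \<odot>\<^bsub>C\<^esub> z"
      by (rule C.lim_to_unique[OF _ _ _ C.lim_to_mult_const[OF lim(1,2) _ lim(3), of z]])
        (use dz lim(1,2) in \<open>simp_all add: c\<close>)
    moreover have "z \<otimes>\<^bsub>C\<^esub> l = d \<odot>\<^bsub>C\<^esub> z"
      by (rule C.lim_to_unique[OF _ _ _ C.lim_to_const_mult[OF lim(1,2) _ lim(3), of z]])
        (use dz lim(1,2) in \<open>simp_all add: c\<close>)
    ultimately show ?case by blast
  qed
qed

sublocale q: central_projection C z
proof
  show "z \<otimes>\<^bsub>C\<^esub> x = x \<otimes>\<^bsub>C\<^esub> z" if "x \<in> carrier C" for x using mult_z_eq_smult[OF that] by auto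
qed (simp_all add: z_adj z_idem)

lemma zero_part_eq: "zero_part S C \<iota> = q.N"
proof -
  have "zero_part S C \<iota> = {c \<odot>\<^bsub>C\<^esub> z | c. True}"
    by (simp add: zero_part_def z_def left_hull_def)
  also have "\<dots> = q.N"
  proof (intro equalityI subsetI)
    fix x assume "x \<in> {c \<odot>\<^bsub>C\<^esub> z | c. True}"
    then obtain c where "x = c \<odot>\<^bsub>C\<^esub> z" by blast
    then have "x = (c \<odot>\<^bsub>C\<^esub> z) \<otimes>\<^bsub>C\<^esub> z" by (simp add: C.smult_mult_l z_idem)
    then show "x \<in> q.N" unfolding q.N_def using C.smult_mem[OF z_closed, of c] by blast
  next
    fix x assume "x \<in> q.N"
    then obtain y where "y \<in> carrier C" "x = y \<otimes>\<^bsub>C\<^esub> z" unfolding q.N_def by blast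
    then show "x \<in> {c \<odot>\<^bsub>C\<^esub> z | c. True}" using mult_z_eq_smult[of y] by auto
  qed
  finally show ?thesis .
qed

lemma reduced_by_zero_eq: "reduced_by_zero S C \<iota> = q.Q"
  by (simp add: reduced_by_zero_def zero_part_eq)

lemma reduced_image_eq: "reduced_image S C \<iota> f = q.cls (\<iota> f)"
  by (simp add: reduced_image_def zero_part_eq q.cls_def)

definition isom :: "'s \<Rightarrow> 'c set" where "isom s = q.cls (\<iota> (ltrans S s))"

text \<open>The empty set is set apart because its identity map need not lie in the hull, and
  outside the hull nothing is known about \<iota>.\<close>

definition proj :: "'s set \<Rightarrow> 'c set" where
  "proj X = (if X = {} then \<zero>\<^bsub>q.Q\<^esub> else q.cls (\<iota> (idm X)))"

lemma proj_eq: assumes "idm X \<in> H" shows "proj X = q.cls (\<iota> (idm X))"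
proof (cases "X = {}")
  case True
  \<comment> \<open>If the empty map does lie in the hull, its image is z, whose class is zero in
    agreement with the default.\<close>
  then have "\<iota> (idm X) = z" using assms by (simp add: z_def)
  then show ?thesis using True by (simp add: proj_def q.zero_quot q.cls_eq_iff) (simp add: q.cut_eq)
qed (simp add: proj_def)

lemma proj_empty [simp]: "proj {} = \<zero>\<^bsub>q.Q\<^esub>"
  by (simp add: proj_def)

text \<open>Li's relations are images of identities between partial bijections; only the empty ideal
  is treated separately.\<close>

lemma li_family_reduced: "li_family S q.Q isom proj"
proof -
  interpret Q: unital_cstar_algebra q.Q by (rule q.quot_unital_cstar)
  note [simp] = left_hull_carrier.gen left_hull_carrier.comp left_hull_carrier.inverse
  have idmH: "idm X \<in> H" "X \<subseteq> carrier S"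
    if "X \<in> constructible_ideals S" for X using idm_constructible that by auto
  have fX: "proj X \<in> carrier q.Q" if "X \<in> constructible_ideals S \<union> {{}}" for X
    using that by (auto simp: proj_eq idmH)
  have "proj (X \<inter> Y) = proj X \<otimes>\<^bsub>q.Q\<^esub> proj Y"
    if "X \<in> constructible_ideals S \<union> {{}}" "Y \<in> constructible_ideals S \<union> {{}}" for X Y
  proof (cases "X = {} \<or> Y = {}")
    case True
    then show ?thesis using fX[OF that(1)] fX[OF that(2)] by (elim disjE) simp_all
  next
    case False
    then have "idm X \<in> H" "idm Y \<in> H" using that idmH by auto
    moreover from this have "idm (X \<inter> Y) \<in> H" unfolding idm_comp[symmetric] by simp
    ultimately show ?thesis by (simp add: proj_eq rep_mult[symmetric] idm_comp)
  qed
  note inter = this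
  have "adj q.Q (proj X) = proj X" if "X \<in> constructible_ideals S \<union> {{}}" for X
  proof (cases "X = {}")
    case False
    then have X: "idm X \<in> H" using that idmH by auto
    have "pinverse (idm X) = idm X" using X by (intro map_eqI) (auto simp: pinverse_Some hull_pinj)
    then show ?thesis using X rep_pinverse[OF X] by (simp add: proj_eq)
  qed simp
  moreover have "isom s \<otimes>\<^bsub>q.Q\<^esub> proj X \<otimes>\<^bsub>q.Q\<^esub> adj q.Q (isom s) = proj (s <# X)"
    if s: "s \<in> carrier S" and X: "X \<in> constructible_ideals S \<union> {{}}" for s X
  proof (cases "X = {}")
    case True
    then show ?thesis using s by (simp add: isom_def l_coset_def)
  next
    case False
    then have X: "idm X \<in> H" "X \<subseteq> carrier S" using X idmH by auto
    have "proj (s <# X) = q.cls (\<iota> (ltrans S s \<circ>\<^sub>m idm X \<circ>\<^sub>m pinverse (ltrans S s)))"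
      using s X by (simp add: proj_eq idm_hull_coset ltrans_conj_idm)
    also have "\<dots> = q.cls (\<iota> (ltrans S s) \<otimes>\<^bsub>C\<^esub> \<iota> (idm X) \<otimes>\<^bsub>C\<^esub> adj C (\<iota> (ltrans S s)))"
      using s X by (simp add: rep_mult rep_pinverse)
    finally show ?thesis using s X by (simp add: isom_def proj_eq)
  qed
  moreover have "proj (carrier S) = \<one>\<^bsub>q.Q\<^esub>"
    by (simp add: proj_eq idm_hull_carrier q.one_quot unit ltrans_one)
  moreover have "isom s \<in> carrier q.Q \<and> adj q.Q (isom s) \<otimes>\<^bsub>q.Q\<^esub> isom s = \<one>\<^bsub>q.Q\<^esub>" if "s \<in> carrier S" for s
    using that by (simp add: isom_def rep_pinverse[symmetric] rep_mult[symmetric] pinverse_ltrans_comp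
        q.one_quot unit)
  moreover have "isom (s \<otimes> t) = isom s \<otimes>\<^bsub>q.Q\<^esub> isom t" if "s \<in> carrier S" "t \<in> carrier S" for s t
    using that by (simp add: isom_def ltrans_mult rep_mult)
  ultimately show ?thesis
    unfolding li_family_def using fX inter inter[of X X for X] by (auto simp del: proj_empty) (simp_all)
qed

end

section \<open>The representation of the left inverse hull in Li's algebra\<close>

locale li_algebra = left_cancellative_monoid S + A: unital_cstar_algebra A
  for S :: "('s, 'm) monoid_scheme" (structure) and A :: "'a cstar" +
  fixes v :: "'s \<Rightarrow> 'a" and e :: "'s set \<Rightarrow> 'a"
  assumes li: "li_family S A v e"
    and gen: "cstar_generated_by A (v ` carrier S \<union> e ` (constructible_ideals S \<union> {{}}))"
begin

lemma v_closed [simp]: "s \<in> carrier S \<Longrightarrow> v s \<in> carrier A"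
  and v_isometry: "s \<in> carrier S \<Longrightarrow> adj A (v s) \<otimes>\<^bsub>A\<^esub> v s = \<one>\<^bsub>A\<^esub>"
  and v_mult: "\<lbrakk>s \<in> carrier S; t \<in> carrier S\<rbrakk> \<Longrightarrow> v (s \<otimes> t) = v s \<otimes>\<^bsub>A\<^esub> v t"
  and e_closed [simp]: "X \<in> constructible_ideals S \<Longrightarrow> e X \<in> carrier A"
  and e_conj: "\<lbrakk>s \<in> carrier S; X \<in> constructible_ideals S\<rbrakk>
    \<Longrightarrow> v s \<otimes>\<^bsub>A\<^esub> e X \<otimes>\<^bsub>A\<^esub> adj A (v s) = e (s <# X)"
  and e_carrier [simp]: "e (carrier S) = \<one>\<^bsub>A\<^esub>"
  and e_empty [simp]: "e {} = \<zero>\<^bsub>A\<^esub>"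
  and e_inter: "\<lbrakk>X \<in> constructible_ideals S; Y \<in> constructible_ideals S\<rbrakk> \<Longrightarrow> e (X \<inter> Y) = e X \<otimes>\<^bsub>A\<^esub> e Y"
  using li unfolding li_family_def by simp_all

lemma carrier_constructible: "carrier S \<in> constructible_ideals S"
proof -
  have "\<one> <# carrier S = carrier S" by (auto simp: l_coset_def)
  then show ?thesis using principal_constructible[of \<one>] by simp
qed

lemma e_principal: "s \<in> carrier S \<Longrightarrow> e (s <# carrier S) = v s \<otimes>\<^bsub>A\<^esub> adj A (v s)"
  using e_conj[of s "carrier S"] by (simp add: carrier_constructible)

text \<open>v_1 is an isometry and idempotent, so multiplying by its adjoint leaves 1.\<close>

lemma v_one: "v \<one> = \<one>\<^bsub>A\<^esub>"
proof -
  have "v \<one> = adj A (v \<one>) \<otimes>\<^bsub>A\<^esub> v \<one> \<otimes>\<^bsub>A\<^esub> v \<one>" by (simp add: v_isometry)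
  also have "\<dots> = adj A (v \<one>) \<otimes>\<^bsub>A\<^esub> v (\<one> \<otimes> \<one>)" by (simp only: v_mult one_closed A.mult_assoc v_closed A.adj_closed)
  also have "\<dots> = \<one>\<^bsub>A\<^esub>" by (simp add: v_isometry)
  finally show ?thesis .
qed

text \<open>The two representations differ by x with xS = S. The range projection of v_x is then e
  of S, that is 1, so v_x and its adjoint cancel in the middle.\<close>

lemma v_frac_eq:
  assumes S: "s \<in> carrier S" "t \<in> carrier S" "p \<in> carrier S" "q \<in> carrier S"
    and eq: "frac s t = frac p q"
  shows "v s \<otimes>\<^bsub>A\<^esub> adj A (v t) = v p \<otimes>\<^bsub>A\<^esub> adj A (v q)"
proof -
  obtain x where x: "x \<in> carrier S" "x <# carrier S = carrier S" "s = p \<otimes> x" "t = q \<otimes> x"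
    using frac_eqD[OF S eq] by metis
  have "v x \<otimes>\<^bsub>A\<^esub> adj A (v x) = \<one>\<^bsub>A\<^esub>" using e_principal[OF x(1)] x(2) by simp
  then have "v p \<otimes>\<^bsub>A\<^esub> (v x \<otimes>\<^bsub>A\<^esub> adj A (v x)) \<otimes>\<^bsub>A\<^esub> adj A (v q) = v p \<otimes>\<^bsub>A\<^esub> adj A (v q)"
    using S by simp
  then show ?thesis using S x(1) by (simp add: x(3,4) v_mult A.adj_mult A.mult_assoc)
qed

text \<open>Inserting the isometry relations on both sides exposes the product of the range
  projections of v_t and v_p, which is e of the empty intersection.\<close>

lemma adj_v_mult_disjoint:
  assumes "t \<in> carrier S" "p \<in> carrier S" "(t <# carrier S) \<inter> (p <# carrier S) = {}"
  shows "adj A (v t) \<otimes>\<^bsub>A\<^esub> v p = \<zero>\<^bsub>A\<^esub>"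
proof -
  have "adj A (v t) \<otimes>\<^bsub>A\<^esub> v p
    = (adj A (v t) \<otimes>\<^bsub>A\<^esub> v t) \<otimes>\<^bsub>A\<^esub> (adj A (v t) \<otimes>\<^bsub>A\<^esub> v p) \<otimes>\<^bsub>A\<^esub> (adj A (v p) \<otimes>\<^bsub>A\<^esub> v p)"
    using assms(1,2) by (simp add: v_isometry)
  also have "\<dots> = adj A (v t) \<otimes>\<^bsub>A\<^esub> (e (t <# carrier S) \<otimes>\<^bsub>A\<^esub> e (p <# carrier S)) \<otimes>\<^bsub>A\<^esub> v p"
    using assms(1,2) by (simp add: e_principal A.mult_assoc)
  also have "\<dots> = \<zero>\<^bsub>A\<^esub>"
    using assms by (simp add: e_inter[symmetric] principal_constructible)
  finally show ?thesis .
qed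

text \<open>The same insertion exposes the projection of the overlap. Writing its left half through
  ta and its right half through pb lets the outer isometries cancel.\<close>

lemma adj_v_mult:
  assumes S: "t \<in> carrier S" "p \<in> carrier S" "a \<in> carrier S" "b \<in> carrier S"
    and ab: "t \<otimes> a = p \<otimes> b"
    and int: "(t <# carrier S) \<inter> (p <# carrier S) = (t \<otimes> a) <# carrier S"
  shows "adj A (v t) \<otimes>\<^bsub>A\<^esub> v p = v a \<otimes>\<^bsub>A\<^esub> adj A (v b)"
proof -
  have "e (t <# carrier S) \<otimes>\<^bsub>A\<^esub> e (p <# carrier S) = e ((t \<otimes> a) <# carrier S)"
    using S by (simp add: e_inter[symmetric] principal_constructible int)
  also have "\<dots> = v (t \<otimes> a) \<otimes>\<^bsub>A\<^esub> adj A (v (t \<otimes> a))"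
    using S by (intro e_principal) simp
  finally have ee: "e (t <# carrier S) \<otimes>\<^bsub>A\<^esub> e (p <# carrier S) = v (t \<otimes> a) \<otimes>\<^bsub>A\<^esub> adj A (v (p \<otimes> b))"
    by (simp only: ab)
  have "adj A (v t) \<otimes>\<^bsub>A\<^esub> v p
    = (adj A (v t) \<otimes>\<^bsub>A\<^esub> v t) \<otimes>\<^bsub>A\<^esub> (adj A (v t) \<otimes>\<^bsub>A\<^esub> v p) \<otimes>\<^bsub>A\<^esub> (adj A (v p) \<otimes>\<^bsub>A\<^esub> v p)"
    using S by (simp add: v_isometry)
  also have "\<dots> = adj A (v t) \<otimes>\<^bsub>A\<^esub> (e (t <# carrier S) \<otimes>\<^bsub>A\<^esub> e (p <# carrier S)) \<otimes>\<^bsub>A\<^esub> v p"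
    using S by (simp add: e_principal A.mult_assoc)
  also have "\<dots> = adj A (v t) \<otimes>\<^bsub>A\<^esub> (v (t \<otimes> a) \<otimes>\<^bsub>A\<^esub> adj A (v (p \<otimes> b))) \<otimes>\<^bsub>A\<^esub> v p"
    by (simp only: ee)
  also have "\<dots> = (adj A (v t) \<otimes>\<^bsub>A\<^esub> v t) \<otimes>\<^bsub>A\<^esub> (v a \<otimes>\<^bsub>A\<^esub> adj A (v b)) \<otimes>\<^bsub>A\<^esub> (adj A (v p) \<otimes>\<^bsub>A\<^esub> v p)"
    using S by (simp add: v_mult A.adj_mult A.mult_assoc)
  also have "\<dots> = v a \<otimes>\<^bsub>A\<^esub> adj A (v b)" using S by (simp add: v_isometry)
  finally show ?thesis .
qed

text \<open>The image of a fraction is chosen among those of all its representations, which agree by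
  \<open>v_frac_eq\<close>. Under Clifford's condition every nonempty element of the hull is such a
  fraction.\<close>

definition \<pi> :: "('s \<rightharpoonup> 's) \<Rightarrow> 'a" where
  "\<pi> g = (if g = Map.empty then \<zero>\<^bsub>A\<^esub>
    else SOME a. \<exists>s\<in>carrier S. \<exists>t\<in>carrier S. g = frac s t \<and> a = v s \<otimes>\<^bsub>A\<^esub> adj A (v t))"

lemma \<pi>_empty [simp]: "\<pi> Map.empty = \<zero>\<^bsub>A\<^esub>"
  by (simp add: \<pi>_def)

lemma \<pi>_frac:
  assumes "s \<in> carrier S" "t \<in> carrier S"
  shows "\<pi> (frac s t) = v s \<otimes>\<^bsub>A\<^esub> adj A (v t)"
proof -
  have "(SOME a. \<exists>p\<in>carrier S. \<exists>q\<in>carrier S. frac s t = frac p q \<and> a = v p \<otimes>\<^bsub>A\<^esub> adj A (v q))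
    = v s \<otimes>\<^bsub>A\<^esub> adj A (v t)"
    by (rule some_equality) (use assms v_frac_eq in metis)+
  then show ?thesis using frac_nonempty[OF assms(2)] by (simp add: \<pi>_def)
qed

context
  assumes clifford: "clifford S"
begin

text \<open>The product of \<open>adj A (v t)\<close> and \<open>v p\<close> follows the same two
  cases as the composition of fractions with inner terms t and p.\<close>

lemma \<pi>_mult:
  assumes "g \<in> H" "h \<in> H"
  shows "\<pi> (g \<circ>\<^sub>m h) = \<pi> g \<otimes>\<^bsub>A\<^esub> \<pi> h"
proof (cases "g = Map.empty \<or> h = Map.empty")
  case True
  then have "g \<circ>\<^sub>m h = Map.empty" by (intro map_eqI) (auto simp: map_comp_Some_iff)
  moreover have "\<pi> k \<in> carrier A" if "k \<in> H" for k
    using hull_clifford[OF clifford that] by (auto simp: \<pi>_frac)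
  ultimately show ?thesis using True assms by auto
next
  case False
  obtain s t where st: "s \<in> carrier S" "t \<in> carrier S" "g = frac s t"
    using hull_clifford[OF clifford assms(1)] False by blast
  obtain p q where pq: "p \<in> carrier S" "q \<in> carrier S" "h = frac p q"
    using hull_clifford[OF clifford assms(2)] False by blast
  have eq: "\<pi> g \<otimes>\<^bsub>A\<^esub> \<pi> h = v s \<otimes>\<^bsub>A\<^esub> (adj A (v t) \<otimes>\<^bsub>A\<^esub> v p) \<otimes>\<^bsub>A\<^esub> adj A (v q)"
    using st pq by (simp add: \<pi>_frac A.mult_assoc)
  show ?thesis
  proof (rule clifford_cases[OF clifford st(2) pq(1)])
    assume d: "(t <# carrier S) \<inter> (p <# carrier S) = {}"
    show ?thesis
      unfolding eq adj_v_mult_disjoint[OF st(2) pq(1) d] unfolding st(3) pq(3)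
        frac_comp_disjoint[OF st(1,2) pq(1,2) d] using st pq by simp
  next
    fix a b
    assume ab: "a \<in> carrier S" "b \<in> carrier S" "t \<otimes> a = p \<otimes> b"
      "(t <# carrier S) \<inter> (p <# carrier S) = (t \<otimes> a) <# carrier S"
    show ?thesis
      unfolding eq adj_v_mult[OF st(2) pq(1) ab] unfolding st(3) pq(3)
        frac_comp[OF st(1,2) pq(1,2) ab]
      using st(1,2) pq(1,2) ab(1,2) by (simp add: \<pi>_frac v_mult A.adj_mult A.mult_assoc)
  qed
qed

lemma pi_representation_\<pi>: "pi_representation (left_hull S) A \<pi>"
proof -
  have "\<pi> g \<in> carrier A \<and> \<pi> g \<otimes>\<^bsub>A\<^esub> adj A (\<pi> g) \<otimes>\<^bsub>A\<^esub> \<pi> g = \<pi> g" if g: "g \<in> H" for g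
  proof (cases "g = Map.empty")
    case False
    then obtain s t where st: "s \<in> carrier S" "t \<in> carrier S" "g = frac s t"
      using hull_clifford[OF clifford g] by blast
    let ?s = "v s" and ?t = "adj A (v t)"
    have "?s \<otimes>\<^bsub>A\<^esub> ?t \<otimes>\<^bsub>A\<^esub> adj A (?s \<otimes>\<^bsub>A\<^esub> ?t) \<otimes>\<^bsub>A\<^esub> (?s \<otimes>\<^bsub>A\<^esub> ?t)
      = ?s \<otimes>\<^bsub>A\<^esub> (?t \<otimes>\<^bsub>A\<^esub> v t) \<otimes>\<^bsub>A\<^esub> (adj A ?s \<otimes>\<^bsub>A\<^esub> ?s) \<otimes>\<^bsub>A\<^esub> ?t"
      using st by (simp add: A.adj_mult A.mult_assoc)
    also have "\<dots> = ?s \<otimes>\<^bsub>A\<^esub> ?t" using st by (simp add: v_isometry)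
    finally show ?thesis using st by (simp add: \<pi>_frac)
  qed simp
  then show ?thesis
    unfolding pi_representation_def left_hull_def hom_def by (simp add: \<pi>_mult)
qed

text \<open>X is empty or principal, and the identity map of rS is the fraction with numerator and
  denominator r.\<close>

lemma \<pi>_idm: "X \<in> constructible_ideals S \<Longrightarrow> \<pi> (idm X) = e X"
  using constructible_clifford[OF clifford, of X]
  by (auto simp: frac_self[symmetric] \<pi>_frac e_principal)

end

end

section \<open>The comparison homomorphism\<close>

locale comparison = li_algebra S A v e + hull: hull_algebra S C \<iota>
  for S :: "('s, 'm) monoid_scheme" (structure) and A :: "'a cstar" and C :: "'c cstar"
    and v :: "'s \<Rightarrow> 'a" and e :: "'s set \<Rightarrow> 'a" and \<iota> :: "('s \<rightharpoonup> 's) \<Rightarrow> 'c" +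
  fixes \<eta> :: "'a \<Rightarrow> 'c set"
  assumes star_hom_\<eta>: "star_hom A hull.q.Q \<eta>"
    and \<eta>_v: "s \<in> carrier S \<Longrightarrow> \<eta> (v s) = hull.isom s"
    and \<eta>_e: "X \<in> constructible_ideals S \<union> {{}} \<Longrightarrow> \<eta> (e X) = hull.proj X"
begin

sublocale Q: unital_cstar_algebra hull.q.Q
  by (rule hull.q.quot_unital_cstar)

sublocale \<eta>: unital_star_hom A hull.q.Q \<eta>
proof
  have "\<eta> \<one>\<^bsub>A\<^esub> = hull.proj (carrier S)"
    using \<eta>_e[of "carrier S"] carrier_constructible by simp
  also have "\<dots> = \<one>\<^bsub>hull.q.Q\<^esub>" using hull.li_family_reduced by (simp add: li_family_def)
  finally show "\<eta> \<one>\<^bsub>A\<^esub> = \<one>\<^bsub>hull.q.Q\<^esub>" .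
qed (rule star_hom_\<eta>)

lemma cls_rep_in_range: "g \<in> H \<Longrightarrow> hull.q.cls (\<iota> g) \<in> \<eta> ` carrier A"
proof (induction rule: left_hull_carrier.induct)
  case (gen s)
  then show ?case using \<eta>_v[of s] v_closed[of s] unfolding hull.isom_def by (metis imageI)
next
  case (comp g h)
  then obtain a b where "a \<in> carrier A" "b \<in> carrier A" "hull.q.cls (\<iota> g) = \<eta> a" "hull.q.cls (\<iota> h) = \<eta> b"
    by blast
  moreover have "hull.q.cls (\<iota> (g \<circ>\<^sub>m h)) = hull.q.cls (\<iota> g) \<otimes>\<^bsub>hull.q.Q\<^esub> hull.q.cls (\<iota> h)"
    using comp by (simp add: hull.rep_mult)
  ultimately have "hull.q.cls (\<iota> (g \<circ>\<^sub>m h)) = \<eta> (a \<otimes>\<^bsub>A\<^esub> b)" by (simp add: \<eta>.hom_mult)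
  then show ?case by (rule image_eqI) (use \<open>a \<in> carrier A\<close> \<open>b \<in> carrier A\<close> in simp)
next
  case (inverse g)
  then obtain a where "a \<in> carrier A" "hull.q.cls (\<iota> g) = \<eta> a" by blast
  moreover have "hull.q.cls (\<iota> (pinverse g)) = adj hull.q.Q (hull.q.cls (\<iota> g))"
    using inverse by (simp add: hull.rep_pinverse)
  ultimately have "hull.q.cls (\<iota> (pinverse g)) = \<eta> (adj A a)" by (simp add: \<eta>.hom_adj)
  then show ?case by (rule image_eqI) (use \<open>a \<in> carrier A\<close> in simp)
qed

text \<open>The elements of \<open>C\<close> whose class lies in the range include the generators
  and are closed under the algebraic operations; the limit case is where closedness of the range
  enters.\<close>

lemma surjective: "\<eta> ` carrier A = carrier hull.q.Q"
proof
  show "\<eta> ` carrier A \<subseteq> carrier hull.q.Q" by auto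
  have "hull.q.cls x \<in> \<eta> ` carrier A" if "x \<in> carrier C" for x
    using hull.gen that
  proof (induction rule: hull.C.generated_induct)
    case (gen x)
    then show ?case using cls_rep_in_range by auto
  next
    case zero
    have "hull.q.cls \<zero>\<^bsub>C\<^esub> = \<eta> \<zero>\<^bsub>A\<^esub>" by (simp add: hull.q.zero_quot)
    then show ?case by (rule image_eqI) simp
  next
    case (add x y)
    then obtain a b where ab: "a \<in> carrier A" "b \<in> carrier A" "hull.q.cls x = \<eta> a" "hull.q.cls y = \<eta> b"
      by blast
    have "hull.q.cls (x \<oplus>\<^bsub>C\<^esub> y) = \<eta> (a \<oplus>\<^bsub>A\<^esub> b)"
      using add(1,2) ab by (simp only: hull.q.cls_add[symmetric] \<eta>.hom_add)
    then show ?case by (rule image_eqI) (use ab in simp)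
  next
    case (smult c x)
    then obtain a where a: "a \<in> carrier A" "hull.q.cls x = \<eta> a" by blast
    have "hull.q.cls (c \<odot>\<^bsub>C\<^esub> x) = \<eta> (c \<odot>\<^bsub>A\<^esub> a)"
      using smult(1) a by (simp only: hull.q.cls_smult[symmetric] \<eta>.hom_smult)
    then show ?case by (rule image_eqI) (use a in simp)
  next
    case (mult x y)
    then obtain a b where ab: "a \<in> carrier A" "b \<in> carrier A" "hull.q.cls x = \<eta> a" "hull.q.cls y = \<eta> b"
      by blast
    have "hull.q.cls (x \<otimes>\<^bsub>C\<^esub> y) = \<eta> (a \<otimes>\<^bsub>A\<^esub> b)"
      using mult(1,2) ab by (simp only: hull.q.cls_mult[symmetric] \<eta>.hom_mult)
    then show ?case by (rule image_eqI) (use ab in simp)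
  next
    case (adj x)
    then obtain a where a: "a \<in> carrier A" "hull.q.cls x = \<eta> a" by blast
    have "hull.q.cls (adj C x) = \<eta> (adj A a)"
      using adj(1) a by (simp only: hull.q.cls_adj[symmetric] \<eta>.hom_adj)
    then show ?case by (rule image_eqI) (use a in simp)
  next
    case (lim g l)
    show ?case
    proof (rule \<eta>.range_closed)
      show "Q.lim_to (\<lambda>n. hull.q.cls (g n)) (hull.q.cls l)"
      proof (rule Q.lim_to_bound)
        show "(\<lambda>n. cnorm C (g n \<ominus>\<^bsub>C\<^esub> l)) \<longlonglongrightarrow> 0" using lim(3) by (simp add: hull.C.lim_to_def)
        show "cnorm hull.q.Q (hull.q.cls (g n) \<ominus>\<^bsub>hull.q.Q\<^esub> hull.q.cls l) \<le> cnorm C (g n \<ominus>\<^bsub>C\<^esub> l)" for n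
          using lim(1,2) by (simp add: hull.q.cnorm_cls_le)
      qed (use lim(1,2) in auto)
    qed (use lim in auto)
  qed
  then show "carrier hull.q.Q \<subseteq> \<eta> ` carrier A" unfolding hull.q.carrier_quot by blast
qed

text \<open>Since \<phi> kills z, it descends to \<psi> on the quotient. The composite \<theta> of
  \<eta> and \<psi> fixes the generators of Li's algebra, hence by continuity all elements.\<close>

lemma injective:
  assumes clifford: "clifford S" and \<phi>: "star_hom C A \<phi>" "\<And>g. g \<in> H \<Longrightarrow> \<phi> (\<iota> g) = \<pi> g"
  shows "inj_on \<eta> (carrier A)"
proof -
  have \<phi>_simps: "x \<in> carrier C \<Longrightarrow> \<phi> x \<in> carrier A"
    "\<lbrakk>x \<in> carrier C; y \<in> carrier C\<rbrakk> \<Longrightarrow> \<phi> (x \<oplus>\<^bsub>C\<^esub> y) = \<phi> x \<oplus>\<^bsub>A\<^esub> \<phi> y"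
    "x \<in> carrier C \<Longrightarrow> \<phi> (c \<odot>\<^bsub>C\<^esub> x) = c \<odot>\<^bsub>A\<^esub> \<phi> x"
    "\<lbrakk>x \<in> carrier C; y \<in> carrier C\<rbrakk> \<Longrightarrow> \<phi> (x \<otimes>\<^bsub>C\<^esub> y) = \<phi> x \<otimes>\<^bsub>A\<^esub> \<phi> y"
    "x \<in> carrier C \<Longrightarrow> \<phi> (adj C x) = adj A (\<phi> x)" for x y c
    using \<phi>(1) unfolding star_hom_def by auto
  have "\<phi> \<zero>\<^bsub>C\<^esub> = \<zero>\<^bsub>A\<^esub>" using \<phi>_simps(3)[of "\<zero>\<^bsub>C\<^esub>" 0] \<phi>_simps(1)[of "\<zero>\<^bsub>C\<^esub>"] by simp
  then have \<phi>z: "\<phi> hull.z = \<zero>\<^bsub>A\<^esub>" using \<phi>(2)[of Map.empty] by (simp add: hull.z_def)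
  have \<phi>cut: "\<phi> x = \<phi> (hull.q.cut x)" if x: "x \<in> carrier C" for x
  proof -
    have "x = hull.q.cut x \<oplus>\<^bsub>C\<^esub> x \<otimes>\<^bsub>C\<^esub> hull.z" using x by (simp add: hull.q.cut_eq)
    then have "\<phi> x = \<phi> (hull.q.cut x) \<oplus>\<^bsub>A\<^esub> \<phi> x \<otimes>\<^bsub>A\<^esub> \<phi> hull.z"
      using x \<phi>_simps(2,4) by (metis hull.C.mult_closed hull.q.cut_closed hull.z_closed)
    then show ?thesis using x \<phi>_simps(1) by (simp add: \<phi>z)
  qed
  \<comment> \<open>A representative is chosen in each class; by \<open>\<phi>cut\<close> the value
    does not depend on it.\<close>
  define \<psi> where "\<psi> K = \<phi> (SOME x. x \<in> carrier C \<and> hull.q.cls x = K)" for K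
  have \<psi>: "\<psi> (hull.q.cls x) = \<phi> x" if x: "x \<in> carrier C" for x
  proof -
    let ?y = "SOME y. y \<in> carrier C \<and> hull.q.cls y = hull.q.cls x"
    have "?y \<in> carrier C \<and> hull.q.cls ?y = hull.q.cls x"
      by (rule someI[of _ x]) (use x in simp)
    then have "hull.q.cut ?y = hull.q.cut x" "?y \<in> carrier C"
      using x by (auto simp: hull.q.cls_eq_iff)
    then have "\<phi> ?y = \<phi> x" using \<phi>cut[of ?y] \<phi>cut[of x] x by simp
    then show ?thesis by (simp add: \<psi>_def)
  qed
  have \<psi>_hom: "star_hom hull.q.Q A \<psi>"
    unfolding star_hom_def hull.q.carrier_quot by (auto simp: \<psi> \<phi>_simps)
  define \<theta> where "\<theta> a = \<psi> (\<eta> a)" for a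
  have \<theta>_hom: "star_hom A A \<theta>"
    using \<psi>_hom star_hom_\<eta> unfolding star_hom_def \<theta>_def by (auto simp: Pi_iff)
  have \<pi>ltrans: "\<pi> (ltrans S s) = v s" if "s \<in> carrier S" for s
    using \<pi>_frac[of s \<one>] that by (simp add: frac_one v_one)
  have \<theta>_v: "\<theta> (v s) = v s" if "s \<in> carrier S" for s
    using that by (simp add: \<theta>_def \<eta>_v hull.isom_def \<psi> \<phi>(2) left_hull_carrier.gen \<pi>ltrans)
  have \<psi>0: "\<psi> \<zero>\<^bsub>hull.q.Q\<^esub> = \<zero>\<^bsub>A\<^esub>"
    by (simp add: hull.q.zero_quot \<psi> \<open>\<phi> \<zero>\<^bsub>C\<^esub> = \<zero>\<^bsub>A\<^esub>\<close>)
  have \<theta>_e: "\<theta> (e X) = e X" if "X \<in> constructible_ideals S \<union> {{}}" for X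
  proof (cases "X = {}")
    case True
    then show ?thesis using \<eta>_e[OF that] \<psi>0 by (simp add: \<theta>_def)
  next
    case False
    then have X: "X \<in> constructible_ideals S" using that by simp
    then have "idm X \<in> H" using idm_constructible by simp
    then show ?thesis using \<eta>_e[OF that] \<pi>_idm[OF clifford X] by (simp add: \<theta>_def hull.proj_eq \<psi> \<phi>(2))
  qed
  interpret \<theta>: unital_star_hom A A \<theta>
  proof
    show "\<theta> \<one>\<^bsub>A\<^esub> = \<one>\<^bsub>A\<^esub>" using \<theta>_v[of \<one>] by (simp add: v_one)
  qed (rule \<theta>_hom)
  have "\<theta> x = x" if "x \<in> carrier A" for x
    using gen that
  proof (induction rule: A.generated_induct)
    case (gen x)
    then show ?case using \<theta>_v \<theta>_e by blast
  next
    case (lim g l)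
    have "A.lim_to g (\<theta> l)" using \<theta>.hom_lim[OF lim(1,2,3)] lim(4) by simp
    then show ?case using A.lim_to_unique[OF lim(1) _ lim(2) _ lim(3)] lim(2) by simp
  qed (simp_all add: \<theta>.hom_add \<theta>.hom_smult \<theta>.hom_mult \<theta>.hom_adj)
  then show ?thesis unfolding \<theta>_def by (rule inj_on_inverseI)
qed

end

theorem proposition3p3p2:
  fixes S :: "('s, 'm) monoid_scheme"
    and A :: "'a cstar" and v :: "'s \<Rightarrow> 'a" and e :: "'s set \<Rightarrow> 'a"
    and C :: "'c cstar" and \<iota> :: "('s \<rightharpoonup> 's) \<Rightarrow> 'c"
  assumes "monoid S" and "left_cancellative S"
    and "li_cstar_algebra TYPE('c set) S A v e"
    and "full_cstar_algebra TYPE('a) (left_hull S) C \<iota>"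
  shows "\<exists>\<eta>. star_hom A (reduced_by_zero S C \<iota>) \<eta> \<and>
           \<eta> ` carrier A = carrier (reduced_by_zero S C \<iota>) \<and>
           (\<forall>s\<in>carrier S. \<eta> (v s) = reduced_image S C \<iota> (ltrans S s)) \<and>
           (clifford S \<longrightarrow> bij_betw \<eta> (carrier A) (carrier (reduced_by_zero S C \<iota>)))"
proof -
  interpret left_cancellative_monoid S
    using assms(1,2) by (intro left_cancellative_monoid.intro left_cancellative_monoid_axioms.intro)
  have A: "unital_cstar_algebra A" "li_family S A v e"
    "cstar_generated_by A (v ` carrier S \<union> e ` (constructible_ideals S \<union> {{}}))"
    and A_univ: "\<And>(B :: 'c set cstar) w f. unital_cstar_algebra B \<Longrightarrow> li_family S B w f \<Longrightarrow>
        \<exists>\<phi>. star_hom A B \<phi> \<and> (\<forall>s\<in>carrier S. \<phi> (v s) = w s) \<and>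
             (\<forall>X\<in>constructible_ideals S \<union> {{}}. \<phi> (e X) = f X)"
    using assms(3) unfolding li_cstar_algebra_def by blast+
  have C: "cstar_algebra C" "pi_representation (left_hull S) C \<iota>" "cstar_generated_by C (\<iota> ` H)"
    and C_univ: "\<And>(B :: 'a cstar) \<pi>. cstar_algebra B \<Longrightarrow> pi_representation (left_hull S) B \<pi> \<Longrightarrow>
        \<exists>\<phi>. star_hom C B \<phi> \<and> (\<forall>p\<in>H. \<phi> (\<iota> p) = \<pi> p)"
    using assms(4) unfolding full_cstar_algebra_def by (simp_all add: left_hull_def)
  define U where "U = \<iota> (ltrans S \<one>\<^bsub>S\<^esub>)"
  \<comment> \<open>Only this field changes, so generation, representations and *-homomorphisms
    carry over from \<open>C\<close>.\<close>
  define C1 where "C1 = C\<lparr>one := U\<rparr>"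
  interpret C: cstar_algebra C by (rule C(1))
  note [simp] = left_hull_carrier.gen
  have \<iota>: "g \<in> H \<Longrightarrow> \<iota> g \<in> carrier C"
    "\<lbrakk>g \<in> H; h \<in> H\<rbrakk> \<Longrightarrow> \<iota> (g \<circ>\<^sub>m h) = \<iota> g \<otimes>\<^bsub>C\<^esub> \<iota> h"
    "g \<in> H \<Longrightarrow> \<iota> g \<otimes>\<^bsub>C\<^esub> adj C (\<iota> g) \<otimes>\<^bsub>C\<^esub> \<iota> g = \<iota> g" for g h
    using C(2) unfolding pi_representation_def by (auto simp: left_hull_def hom_def)
  have U [simp]: "U \<in> carrier C" by (simp add: U_def \<iota>)
  \<comment> \<open>Self-adjointness of the unit is what the adjoint case of the following induction
    rests on; \<lambda>_1 is idempotent.\<close>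
  have U_adj: "adj C U = U"
    unfolding U_def
    by (rule C.idempotent_partial_isometry_selfadjoint)
      (simp_all add: \<iota> ltrans_one_comp flip: \<iota>(2))
  have "U \<otimes>\<^bsub>C\<^esub> x = x \<and> x \<otimes>\<^bsub>C\<^esub> U = x" if "x \<in> carrier C" for x
    using C(3) that
  proof (induction rule: C.generated_induct)
    case (gen x)
    then show ?case by (auto simp: U_def ltrans_one_comp simp flip: \<iota>(2))
  next
    case (mult x y)
    then show ?case by (metis C.mult_assoc U)
  next
    case (adj x)
    then show ?case by (metis C.adj_mult U U_adj)
  next
    case (lim f l)
    have "U \<otimes>\<^bsub>C\<^esub> l = l" "l \<otimes>\<^bsub>C\<^esub> U = l"
      using C.lim_to_unique[OF lim(1) _ lim(2) _ lim(3), of "U \<otimes>\<^bsub>C\<^esub> l"]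
        C.lim_to_unique[OF lim(1) _ lim(2) _ lim(3), of "l \<otimes>\<^bsub>C\<^esub> U"]
        C.lim_to_const_mult[OF lim(1,2) U lim(3)] C.lim_to_mult_const[OF lim(1,2) U lim(3)] lim(2,4)
      by simp_all
    then show ?case by simp
  qed (simp_all add: C.mult_l_distr C.mult_r_distr C.smult_mult_l C.smult_mult_r)
  then have "unital_cstar_algebra C1"
    unfolding C1_def using cstar_algebra_one_update[OF C(1), of U]
    by (intro unital_cstar_algebra.intro unital_cstar_algebra_axioms.intro) simp_all
  then interpret hull: hull_algebra S C1 \<iota>
    using C(2,3) left_cancellative_monoid_axioms
    by (intro hull_algebra.intro hull_algebra_axioms.intro) (simp_all add: C1_def U_def)
  have zero_part: "zero_part S C1 \<iota> = zero_part S C \<iota>"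
    by (simp add: zero_part_def C1_def)
  have reduced: "hull.q.Q = (reduced_by_zero S C \<iota>)\<lparr>one := zero_part S C \<iota> +>\<^bsub>C\<^esub> U\<rparr>"
    unfolding hull.reduced_by_zero_eq[symmetric]
    by (simp add: reduced_by_zero_def zero_part) (simp add: C1_def cstar_quot_one_update)
  have image: "hull.isom s = reduced_image S C \<iota> (ltrans S s)" for s
    unfolding hull.isom_def hull.reduced_image_eq[symmetric]
    by (simp add: reduced_image_def zero_part) (simp add: C1_def)
  \<comment> \<open>The quotient is carried by cosets, which is why the universal property of
    \<open>A\<close> is assumed at type \<open>'c set\<close>.\<close>
  obtain \<eta> where \<eta>: "star_hom A hull.q.Q \<eta>" "\<forall>s\<in>carrier S. \<eta> (v s) = hull.isom s"
    "\<forall>X\<in>constructible_ideals S \<union> {{}}. \<eta> (e X) = hull.proj X"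
    using A_univ[OF hull.q.quot_unital_cstar hull.li_family_reduced] by blast
  interpret comparison S A C1 v e \<iota> \<eta>
    using A \<eta> by (intro comparison.intro li_algebra.intro li_algebra_axioms.intro comparison_axioms.intro
      left_cancellative_monoid_axioms hull.hull_algebra_axioms) blast+
  have "inj_on \<eta> (carrier A)" if clifford: "clifford S"
  proof -
    \<comment> \<open>Here Li's algebra itself is the target, hence the universal property of
      \<open>C\<close> at type \<open>'a\<close>.\<close>
    obtain \<phi> where \<phi>: "star_hom C A \<phi>" "\<forall>p\<in>H. \<phi> (\<iota> p) = \<pi> p"
      using C_univ[OF A.cstar_algebra_axioms pi_representation_\<pi>[OF clifford]] by blast
    then have "star_hom C1 A \<phi>" by (simp add: C1_def)
    with \<phi>(2) show ?thesis using injective[OF clifford] by blast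
  qed
  with surjective have bij: "clifford S \<longrightarrow> bij_betw \<eta> (carrier A) (carrier (reduced_by_zero S C \<iota>))"
    by (simp add: bij_betw_def reduced)
  show ?thesis
    using \<eta>(1,2) surjective bij by (intro exI[of _ \<eta>]) (simp add: reduced image)
qed

end
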